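(* For any topological group $X$, the semidirect product $\mathrm{HM}_0(X)\rtimes_{\alpha_X}\mathbb Z$ is a topological group which is duoseparable and contains an isomorphic topological copy of $X$ (i.e., a subgroup that, with the subspace topology, is topologically isomorphic to $X$).
   Context: A topological group $G$ is duoseparable if it contains a countable subset $S$ such that $G=SUS$ for every neighborhood $U\subseteq G$ of the unit, where $AB=\{ab:a\in A,\ b\in B\}$. Hartman–Mycielski construction: for a topological group $X$ with unit $1_X$, $\mathrm{HM}(X)$ is the set of all functions $f:[0,1)\to X$ for which there is a sequence $0=a_0<a_1<\dots<a_n=1$ such that $f$ is constant on $[a_i,a_{i+1})$ for every $i<n$. It carries the topology generated by the subbase of sets $N(U,a,b;\varepsilon)=\{f\in \mathrm{HM}(X):\lambda([a,b)\setminus f^{-1}(U))<\varepsilon\}$, where $U\subseteq X$ is open, $0\le a<b\le 1$, $\varepsilon>0$, and $\lambda$ is Lebesgue measure on $[0,1)$, and the pointwise operation $(fg)(t)=f(t)g(t)$. Then $\mathrm{HM}_0(X)=\{f\in \mathrm{HM}(X): f(0)=1_X\}$, with the subspace topology and induced operation. The automorphism $\alpha_X:\mathrm{HM}_0(X)\to \mathrm{HM}_0(X)$ is $\alpha_X(\gamma)=\gamma\circ s$, where $s:[0,1)\to[0,1)$, $s(t)=t^2$. For an automorphism $\alpha$ (algebraic automorphism that is a homeomorphism) of $Y$, the semidirect product $Y\rtimes_\alpha\mathbb Z$ is the product space $Y\times\mathbb Z$ ($\mathbb Z$ the discrete additive group of integers) with the operation $(x,n)*(y,m)=(x\cdot\alpha^n(y),\,n+m)$.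 *)

theory Defs
  imports "HOL-Analysis.Analysis" "HOL-Algebra.Coset" "HOL-Algebra.Bij"
begin

text \<open>No separation axiom is assumed.\<close>

definition topological_group :: "('a, 'b) monoid_scheme \<Rightarrow> 'a topology \<Rightarrow> bool" where
  "topological_group G T \<longleftrightarrow>
     group G \<and> topspace T = carrier G \<and>
     continuous_map (prod_topology T T) T (\<lambda>(x, y). x \<otimes>\<^bsub>G\<^esub> y) \<and>
     continuous_map T T (\<lambda>x. inv\<^bsub>G\<^esub> x)"

text \<open>A neighborhood of the unit need not be open: it is a set \<open>U\<close> with an open \<open>V \<subseteq> U\<close>
  containing the unit.\<close>

definition duoseparable :: "('a, 'b) monoid_scheme \<Rightarrow> 'a topology \<Rightarrow> bool" where
  "duoseparable G T \<longleftrightarrow>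
     (\<exists>S \<subseteq> carrier G. countable S \<and>
        (\<forall>U \<subseteq> carrier G. (\<exists>V \<subseteq> U. openin T V \<and> \<one>\<^bsub>G\<^esub> \<in> V) \<longrightarrow>
           carrier G = (S <#>\<^bsub>G\<^esub> U) <#>\<^bsub>G\<^esub> S))"

definition contains_topological_copy ::
  "('a, 'b) monoid_scheme \<Rightarrow> 'a topology \<Rightarrow> ('c, 'd) monoid_scheme \<Rightarrow> 'c topology \<Rightarrow> bool" where
  "contains_topological_copy G T X T\<^sub>X \<longleftrightarrow>
     (\<exists>H h. subgroup H G \<and> h \<in> iso X (G\<lparr>carrier := H\<rparr>) \<and>
            homeomorphic_map T\<^sub>X (subtopology T H) h)"

text \<open>Functions on \<open>[0,1)\<close> are represented as functions on \<^typ>\<open>real\<close> that are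
  \<^const>\<open>undefined\<close> outside \<open>[0,1)\<close>, so that equality is equality on \<open>[0,1)\<close>.\<close>

definition HM :: "('a, 'b) monoid_scheme \<Rightarrow> (real \<Rightarrow> 'a) monoid" where
  "HM X =
     \<lparr>carrier = {f \<in> {0..<1} \<rightarrow>\<^sub>E carrier X.
         \<exists>(n::nat) (a::nat \<Rightarrow> real). a 0 = 0 \<and> a n = 1 \<and> (\<forall>i<n. a i < a (Suc i)) \<and>
            (\<forall>i<n. f constant_on {a i..<a (Suc i)})},
      mult = (\<lambda>f g. \<lambda>t\<in>{0..<1}. f t \<otimes>\<^bsub>X\<^esub> g t),
      one = (\<lambda>t\<in>{0..<1}. \<one>\<^bsub>X\<^esub>)\<rparr>"

definition HM_subbasic ::
  "('a, 'b) monoid_scheme \<Rightarrow> 'a set \<Rightarrow> real \<Rightarrow> real \<Rightarrow> real \<Rightarrow> (real \<Rightarrow> 'a) set" where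
  "HM_subbasic X U a b \<epsilon> =
     {f \<in> carrier (HM X). measure lebesgue ({a..<b} - {t \<in> {0..<1}. f t \<in> U}) < \<epsilon>}"

definition HM_topology ::
  "('a, 'b) monoid_scheme \<Rightarrow> 'a topology \<Rightarrow> (real \<Rightarrow> 'a) topology" where
  "HM_topology X T = topology_generated_by
     {HM_subbasic X U a b \<epsilon> | U a b \<epsilon>. openin T U \<and> 0 \<le> a \<and> a < b \<and> b \<le> 1 \<and> 0 < \<epsilon>}"

definition HM0 :: "('a, 'b) monoid_scheme \<Rightarrow> (real \<Rightarrow> 'a) monoid" where
  "HM0 X = (HM X)\<lparr>carrier := {f \<in> carrier (HM X). f 0 = \<one>\<^bsub>X\<^esub>}\<rparr>"

definition HM0_topology ::
  "('a, 'b) monoid_scheme \<Rightarrow> 'a topology \<Rightarrow> (real \<Rightarrow> 'a) topology" where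
  "HM0_topology X T = subtopology (HM_topology X T) (carrier (HM0 X))"

text \<open>The outer restriction makes the map extensional, as required of the elements of
  \<^const>\<open>auto\<close>.\<close>

definition HM0_aut :: "('a, 'b) monoid_scheme \<Rightarrow> (real \<Rightarrow> 'a) \<Rightarrow> (real \<Rightarrow> 'a)" where
  "HM0_aut X = (\<lambda>\<gamma>\<in>carrier (HM0 X). \<lambda>t\<in>{0..<1}. \<gamma> (t\<^sup>2))"

text \<open>Integer powers of \<open>\<alpha>\<close> are taken in the group of automorphisms of \<open>Y\<close> under composition;
  the definition is meant for \<open>\<alpha> \<in> auto Y\<close>.\<close>

definition semidirect_int :: "('a, 'b) monoid_scheme \<Rightarrow> ('a \<Rightarrow> 'a) \<Rightarrow> ('a \<times> int) monoid" where
  "semidirect_int Y \<alpha> =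
     \<lparr>carrier = carrier Y \<times> UNIV,
      mult = (\<lambda>(x, n) (y, m). (x \<otimes>\<^bsub>Y\<^esub> (\<alpha> [^]\<^bsub>AutoGroup Y\<^esub> n) y, n + m)),
      one = (\<one>\<^bsub>Y\<^esub>, 0)\<rparr>"

definition semidirect_int_topology :: "'a topology \<Rightarrow> ('a \<times> int) topology" where
  "semidirect_int_topology T = prod_topology T (discrete_topology UNIV)"

end

theory Submission
  imports Defs
begin

text \<open>At an element \<open>f\<close> of \<open>HM X\<close> the sets \<open>{g. \<lambda>{t. g t \<notin> V t} < \<delta>}\<close>, where \<open>V\<close> is a step function whose
  values are open sets with \<open>f t \<in> V t\<close>, form a neighborhood base. With this base continuity of the
  group operations is checked pointwise in \<open>t\<close>, and continuity of \<open>\<alpha>\<close> and its inverse says that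
  \<open>t \<mapsto> t\<^sup>2\<close> and the square root carry sets of small measure to sets of small measure.
  An element \<open>\<gamma>\<close> of \<open>HM0 X\<close> is \<open>1\<close> on some \<open>[0,c)\<close>, so \<open>\<alpha>\<^sup>m \<gamma>\<close>, which is \<open>1\<close> wherever
  \<open>t\<close> to the power \<open>2\<^sup>m\<close> is below \<open>c\<close>, tends to \<open>1\<close>. Hence \<open>S = {1} \<times> \<int>\<close> witnesses duoseparability:
  \<open>(\<gamma>, k) = (1, -m) (\<alpha>\<^sup>m \<gamma>, 0) (1, m + k)\<close>. The copy of \<open>X\<close> consists of the functions that are
  \<open>1\<close> on \<open>[0,1/2)\<close> and constant on \<open>[1/2,1)\<close>.\<close>

section \<open>Step functions on the unit interval\<close>

text \<open>Evaluation at a point is in general not continuous in this topology, so closeness at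
  each t has to be replaced by one open set per interval together with a bound on the total measure
  of the exceptional arguments. The subbase does not give this directly: an element of
  \<open>HM_subbasic X U a b \<epsilon>\<close> may itself miss \<open>U\<close> on part of [a,b),
  so that set is not centred at the element. Step functions of open sets give neighborhoods centred
  at f without any countability or separation property of X. The condition f 0 = 1 is what makes
  attraction possible: composition with t^2 fixes constant functions, whereas iterated squaring
  drives every t < 1 towards 0, where f is 1. Squaring does not preserve measure and its inverse is
  not Lipschitz at 0, so a separate estimate is required there. Both directions matter, because the
  integers act by negative powers as well.\<close>

text \<open>\<open>D\<close> contains all jumps. Unlike ordered partitions, such sets are refined simply by taking unions.
  Values outside \<open>[0,1)\<close> are irrelevant.\<close>

definition step :: "(real \<Rightarrow> 'c) \<Rightarrow> bool" where
  "step F \<longleftrightarrow> (\<exists>D. finite D \<and>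
     (\<forall>s t. 0 \<le> s \<longrightarrow> s \<le> t \<longrightarrow> t < 1 \<longrightarrow> D \<inter> {s<..t} = {} \<longrightarrow> F s = F t))"

lemma stepI:
  assumes "finite D"
    and "\<And>s t. 0 \<le> s \<Longrightarrow> s \<le> t \<Longrightarrow> t < 1 \<Longrightarrow> D \<inter> {s<..t} = {} \<Longrightarrow> F s = F t"
  shows "step F"
  using assms unfolding step_def by blast

lemma step_const: "step (\<lambda>t. c)"
  by (rule stepI[of "{}"]) auto

text \<open>The test set \<open>{s<..t}\<close> in \<open>step\<close> omits s and contains t
  because pieces are closed on the left: a value can change only on reaching a left end
  point.\<close>

lemma step_interval: "step (\<lambda>t. t \<in> {a..<b})"
  by (rule stepI[of "{a, b}"]) auto

lemma step_Pair:
  assumes "step F" "step G"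
  shows "step (\<lambda>t. (F t, G t))"
proof -
  obtain D E where "finite D" "finite E"
    and D: "\<And>s t. 0 \<le> s \<Longrightarrow> s \<le> t \<Longrightarrow> t < 1 \<Longrightarrow> D \<inter> {s<..t} = {} \<Longrightarrow> F s = F t"
    and E: "\<And>s t. 0 \<le> s \<Longrightarrow> s \<le> t \<Longrightarrow> t < 1 \<Longrightarrow> E \<inter> {s<..t} = {} \<Longrightarrow> G s = G t"
    using assms unfolding step_def by metis
  show ?thesis
  proof (rule stepI[of "D \<union> E"])
    fix s t :: real
    assume "0 \<le> s" "s \<le> t" "t < 1" and "(D \<union> E) \<inter> {s<..t} = {}"
    moreover from this have "D \<inter> {s<..t} = {}" "E \<inter> {s<..t} = {}" by blast+
    ultimately show "(F s, G s) = (F t, G t)" using D E by blast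
  qed (use \<open>finite D\<close> \<open>finite E\<close> in simp)
qed

lemma step_comp: "step F \<Longrightarrow> step (\<lambda>t. h (F t))"
  unfolding step_def by metis

lemma step_comp2: "step F \<Longrightarrow> step G \<Longrightarrow> step (\<lambda>t. h (F t) (G t))"
  using step_comp[OF step_Pair, of F G "\<lambda>(x, y). h x y"] by simp

lemma step_cong:
  assumes "step F" "\<And>t. t \<in> {0..<1} \<Longrightarrow> F t = G t"
  shows "step G"
proof -
  obtain D where "finite D"
    and D: "\<And>s t. 0 \<le> s \<Longrightarrow> s \<le> t \<Longrightarrow> t < 1 \<Longrightarrow> D \<inter> {s<..t} = {} \<Longrightarrow> F s = F t"
    using assms(1) unfolding step_def by metis
  show ?thesis
  proof (rule stepI[OF \<open>finite D\<close>])
    fix s t :: real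
    assume st: "0 \<le> s" "s \<le> t" "t < 1" "D \<inter> {s<..t} = {}"
    from D[OF this] assms(2)[of s] assms(2)[of t] st show "G s = G t" by auto
  qed
qed

text \<open>The preimage of the jump set D under \<phi> is finite because \<phi> is injective.
  Surjectivity and monotonicity turn each jump in (\<phi> s, \<phi> t] into a point of that preimage
  in (s, t].\<close>

lemma step_reparam:
  assumes "step F"
    and \<phi>: "\<And>t. t \<in> {0..<1} \<Longrightarrow> \<phi> t \<in> {0..<1}"
    and mono: "\<And>s t. 0 \<le> s \<Longrightarrow> s \<le> t \<Longrightarrow> t < 1 \<Longrightarrow> \<phi> s \<le> \<phi> t"
    and inj: "inj_on \<phi> {0..<1}" and surj: "{0..<1} \<subseteq> \<phi> ` {0..<1}"
  shows "step (\<lambda>t. F (\<phi> t))"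
proof -
  obtain D where "finite D"
    and D: "\<And>s t. 0 \<le> s \<Longrightarrow> s \<le> t \<Longrightarrow> t < 1 \<Longrightarrow> D \<inter> {s<..t} = {} \<Longrightarrow> F s = F t"
    using assms(1) unfolding step_def by metis
  show ?thesis
  proof (rule stepI)
    show "finite (\<phi> -` D \<inter> {0..<1})"
      using finite_vimage_IntI[OF \<open>finite D\<close> inj] .
    fix s t :: real
    assume st: "0 \<le> s" "s \<le> t" "t < 1" and E: "\<phi> -` D \<inter> {0..<1} \<inter> {s<..t} = {}"
    show "F (\<phi> s) = F (\<phi> t)"
    proof (rule D)
      show "D \<inter> {\<phi> s<..\<phi> t} = {}"
      proof (rule ccontr)
        assume "D \<inter> {\<phi> s<..\<phi> t} \<noteq> {}"
        then obtain d where d: "d \<in> D" "\<phi> s < d" "d \<le> \<phi> t" by auto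
        have "d \<in> {0..<1}" using d \<phi>[of s] \<phi>[of t] st by auto
        then obtain u where u: "u \<in> {0..<1}" "\<phi> u = d" using surj by blast
        \<comment> \<open>Here u \<le> s would give d \<le> \<phi> s. For the other bound, t \<le> u
          gives \<phi> t = d, and then injectivity forces u = t.\<close>
        have "s < u" using mono[of u s] u d st by fastforce
        moreover have "u \<le> t"
          using mono[of t u] u d st inj_onD[OF inj, of t u] by fastforce
        ultimately show False using E u d by auto
      qed
    qed (use \<phi>[of s] \<phi>[of t] mono st in auto)
  qed
qed

section \<open>Step functions and ordered partitions\<close>

definition unit_partition :: "nat \<Rightarrow> (nat \<Rightarrow> real) \<Rightarrow> bool" where
  "unit_partition n a \<longleftrightarrow> a 0 = 0 \<and> a n = 1 \<and> (\<forall>i<n. a i < a (Suc i))"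

lemma unit_partition_less:
  assumes "unit_partition n a" "i < j" "j \<le> n"
  shows "a i < a j"
  using assms(2,3)
proof (induction j)
  case (Suc j)
  have "a j < a (Suc j)" using assms(1) Suc.prems unfolding unit_partition_def by auto
  with Suc show ?case by (cases "i = j") auto
qed simp

lemma unit_partition_cover:
  assumes "unit_partition n a" "t \<in> {0..<1}"
  obtains i where "i < n" "t \<in> {a i..<a (Suc i)}"
proof -
  define k where "k = (LEAST k. t < a k)"
  have n: "t < a n" using assms unfolding unit_partition_def by auto
  have k: "t < a k" unfolding k_def by (rule LeastI[of "\<lambda>k. t < a k", OF n])
  have "k \<le> n" unfolding k_def by (rule Least_le[of "\<lambda>k. t < a k", OF n])
  have "k \<noteq> 0"
  proof
    assume "k = 0"
    with k assms show False by (auto simp: unit_partition_def)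
  qed
  then obtain i where i: "k = Suc i" by (cases k) auto
  have "\<not> t < a i" using i not_less_Least[of i "\<lambda>k. t < a k"] k_def by simp
  with k i \<open>k \<le> n\<close> show thesis by (intro that[of i]) auto
qed

lemma unit_partition_subset:
  assumes "unit_partition n a" "i < n"
  shows "0 \<le> a i" "a i < a (Suc i)" "a (Suc i) \<le> 1" "{a i..<a (Suc i)} \<subseteq> {0..<1}"
proof -
  show 1: "a i < a (Suc i)" using assms unfolding unit_partition_def by auto
  show 2: "0 \<le> a i"
  proof (cases "i = 0")
    case False
    then have "a 0 < a i" using unit_partition_less[OF assms(1), of 0 i] assms(2) by simp
    then show ?thesis using assms(1) by (simp add: unit_partition_def)
  qed (use assms(1) in \<open>simp add: unit_partition_def\<close>)
  show 3: "a (Suc i) \<le> 1"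
  proof (cases "Suc i = n")
    case False
    then have "a (Suc i) < a n" using unit_partition_less[OF assms(1), of "Suc i" n] assms(2) by simp
    then show ?thesis using assms(1) by (simp add: unit_partition_def)
  qed (use assms(1) in \<open>simp add: unit_partition_def\<close>)
  show "{a i..<a (Suc i)} \<subseteq> {0..<1}" using 1 2 3 by auto
qed

text \<open>Sorting the jumps that lie in [0,1], with 0 and 1 adjoined, gives the partition: no jump
  lies strictly between consecutive points, so F keeps its value at the left end point.\<close>

lemma step_imp_partition:
  assumes "step F"
  obtains n a where "unit_partition n a" "\<And>i t. i < n \<Longrightarrow> t \<in> {a i..<a (Suc i)} \<Longrightarrow> F t = F (a i)"
proof -
  obtain D where "finite D"
    and D: "\<And>s t. 0 \<le> s \<Longrightarrow> s \<le> t \<Longrightarrow> t < 1 \<Longrightarrow> D \<inter> {s<..t} = {} \<Longrightarrow> F s = F t"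
    using assms unfolding step_def by metis
  define E where "E = insert 0 (insert 1 (D \<inter> {0..1}))"
  define xs where "xs = sorted_list_of_set E"
  have "finite E" unfolding E_def using \<open>finite D\<close> by simp
  have xs: "set xs = E" "sorted_wrt (<) xs"
    unfolding xs_def using \<open>finite E\<close> by (auto simp: strict_sorted_iff)
  have len: "length xs > 0" using xs(1) unfolding E_def by (cases xs) auto
  \<comment> \<open>n counts intervals, one fewer than the points; the valid indices into
    \<open>xs\<close> are i \<le> n.\<close>
  define n where "n = length xs - 1"
  have less: "xs ! i < xs ! j" if "i < j" "j \<le> n" for i j
    using sorted_wrt_nth_less[OF xs(2), of i j] that len unfolding n_def by auto
  have n_less: "i < length xs \<longleftrightarrow> i \<le> n" for i
    using len unfolding n_def by linarith
  have range: "xs ! i \<in> E" if "i \<le> n" for i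
    using nth_mem[of i xs] that n_less xs(1) by simp
  have surj: "\<exists>i\<le>n. e = xs ! i" if "e \<in> E" for e
    using in_set_conv_nth[of e xs] that n_less xs(1) by auto
  have bound: "0 \<le> xs ! i" "xs ! i \<le> 1" if "i \<le> n" for i
    using range[OF that] unfolding E_def by auto
  have a0: "xs ! 0 = 0"
  proof -
    obtain i where i: "i \<le> n" "0 = xs ! i" using surj[of 0] unfolding E_def by auto
    show ?thesis using less[of 0 i] i bound(1)[of 0] by (cases "i = 0") auto
  qed
  have an: "xs ! n = 1"
  proof -
    obtain i where i: "i \<le> n" "1 = xs ! i" using surj[of 1] unfolding E_def by auto
    show ?thesis using less[of i n] i bound(2)[of n] by (cases "i = n") auto
  qed
  have part: "unit_partition n (\<lambda>i. xs ! i)"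
    unfolding unit_partition_def using a0 an less by auto
  show thesis
  proof (rule that[OF part])
    fix i t assume i: "i < n" and t: "t \<in> {xs ! i..<xs ! Suc i}"
    have bounds: "0 \<le> xs ! i" "xs ! Suc i \<le> 1"
      using bound(1)[of i] bound(2)[of "Suc i"] i by auto
    have "F (xs ! i) = F t"
    proof (rule D)
      show "D \<inter> {xs ! i<..t} = {}"
      proof (rule ccontr)
        assume "D \<inter> {xs ! i<..t} \<noteq> {}"
        then obtain d where d: "d \<in> D" "xs ! i < d" "d \<le> t" by auto
        then have "d \<in> E" using bounds t unfolding E_def by auto
        then obtain j where j: "j \<le> n" "d = xs ! j" using surj by blast
        \<comment> \<open>The index j of a jump inside the piece would have to satisfy i < j < Suc
          i.\<close>
        have "\<not> j \<le> i" using less[of j i] j d i by (cases "j = i") auto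
        moreover have "\<not> Suc i \<le> j" using less[of "Suc i" j] j d t by (cases "j = Suc i") auto
        ultimately show False by simp
      qed
    qed (use bounds t in auto)
    then show "F t = F (xs ! i)" by simp
  qed
qed

text \<open>The partition points serve as jump set: if none of them lies in (s, t], the right end
  point of the piece containing s exceeds t, so t lies in the same piece.\<close>

lemma partition_imp_step:
  assumes "unit_partition n a" "\<And>i. i < n \<Longrightarrow> F constant_on {a i..<a (Suc i)}"
  shows "step F"
proof (rule stepI)
  show "finite (a ` {..n})" by simp
  fix s t :: real
  assume st: "0 \<le> s" "s \<le> t" "t < 1" and E: "a ` {..n} \<inter> {s<..t} = {}"
  have "s \<in> {0..<1}" using st by simp
  then obtain i where i: "i < n" "s \<in> {a i..<a (Suc i)}"
    by (rule unit_partition_cover[OF assms(1)])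
  have "\<not> a (Suc i) \<le> t"
  proof
    assume "a (Suc i) \<le> t"
    then have "a (Suc i) \<in> a ` {..n} \<inter> {s<..t}" using i by (intro IntI imageI) auto
    then show False using E by simp
  qed
  then have "t \<in> {a i..<a (Suc i)}" using i st by auto
  moreover obtain c where "\<forall>x\<in>{a i..<a (Suc i)}. F x = c"
    using assms(2)[OF i(1)] unfolding constant_on_def by blast
  ultimately show "F s = F t" using i(2) by simp
qed

text \<open>From here on membership is handled through \<open>step\<close>; a partition is chosen
  again only to split a set into finitely many intervals or to obtain the first piece.\<close>

lemma HM_carrier_iff:
  "f \<in> carrier (HM X) \<longleftrightarrow> f \<in> {0..<1} \<rightarrow>\<^sub>E carrier X \<and> step f"
proof -
  have "step f \<longleftrightarrow> (\<exists>n a. unit_partition n a \<and> (\<forall>i<n. f constant_on {a i..<a (Suc i)}))"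
  proof
    assume "step f"
    then obtain n a where "unit_partition n a"
      and "\<And>i t. i < n \<Longrightarrow> t \<in> {a i..<a (Suc i)} \<Longrightarrow> f t = f (a i)"
      using step_imp_partition by blast
    then show "\<exists>n a. unit_partition n a \<and> (\<forall>i<n. f constant_on {a i..<a (Suc i)})"
      unfolding constant_on_def by blast
  qed (use partition_imp_step in blast)
  then show ?thesis unfolding HM_def unit_partition_def by auto
qed

text \<open>\<open>measure\<close> is monotone and subadditive only on measurable sets, so
  exceptional sets have to be measurable. They are finite unions of pieces, because the predicate P
  is itself a step function.\<close>

lemma step_lmeasurable:
  assumes "step P"
  shows "{t \<in> {0..<1}. P t} \<in> lmeasurable"
proof -
  obtain n a where part: "unit_partition n a"
    and a: "\<And>i t. i < n \<Longrightarrow> t \<in> {a i..<a (Suc i)} \<Longrightarrow> P t = P (a i)"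
    using step_imp_partition[OF assms] by blast
  have "{t \<in> {0..<1}. P t} = (\<Union>i\<in>{i. i < n \<and> P (a i)}. {a i..<a (Suc i)})"
  proof (intro subset_antisym subsetI)
    fix t assume "t \<in> {t \<in> {0..<1}. P t}"
    then have "P t" "t \<in> {0..<1}" by auto
    from this(2) obtain i where "i < n" "t \<in> {a i..<a (Suc i)}"
      by (rule unit_partition_cover[OF part])
    then show "t \<in> (\<Union>i\<in>{i. i < n \<and> P (a i)}. {a i..<a (Suc i)})"
      using a \<open>P t\<close> by blast
  next
    fix t assume "t \<in> (\<Union>i\<in>{i. i < n \<and> P (a i)}. {a i..<a (Suc i)})"
    then obtain i where i: "i < n" "P (a i)" "t \<in> {a i..<a (Suc i)}" by auto
    then have "P t" using a[OF i(1,3)] by simp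
    moreover have "t \<in> {0..<1}" using unit_partition_subset(4)[OF part i(1)] i(3) by blast
    ultimately show "t \<in> {t \<in> {0..<1}. P t}" by simp
  qed
  also have "\<dots> \<in> lmeasurable" by (intro fmeasurable.finite_UN bounded_set_imp_lmeasurable) auto
  finally show ?thesis .
qed

section \<open>A neighborhood base of \<open>HM X\<close>\<close>

text \<open>The values of V are arbitrary sets, so that subbasic sets take the same form; openness
  and f t \<in> V t are imposed separately by \<open>open_step_cover\<close>.\<close>

definition HM_nbhd :: "('a, 'b) monoid_scheme \<Rightarrow> (real \<Rightarrow> 'a set) \<Rightarrow> real \<Rightarrow> (real \<Rightarrow> 'a) set" where
  "HM_nbhd X V \<delta> = {f \<in> carrier (HM X). measure lebesgue {t \<in> {0..<1}. f t \<notin> V t} < \<delta>}"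

definition open_step_cover :: "'a topology \<Rightarrow> (real \<Rightarrow> 'a) \<Rightarrow> (real \<Rightarrow> 'a set) \<Rightarrow> bool" where
  "open_step_cover T f V \<longleftrightarrow>
     step V \<and> (\<forall>t\<in>{0..<1}. openin T (V t) \<and> f t \<in> V t)"

lemma HM_carrier_step: "f \<in> carrier (HM X) \<Longrightarrow> step f"
  by (simp add: HM_carrier_iff)

lemma HM_carrier_in: "f \<in> carrier (HM X) \<Longrightarrow> t \<in> {0..<1} \<Longrightarrow> f t \<in> carrier X"
  by (auto simp: HM_carrier_iff)

lemma bad_set_lmeasurable:
  "step f \<Longrightarrow> step V \<Longrightarrow> {t \<in> {0..<1}. f t \<notin> V t} \<in> lmeasurable"
  by (intro step_lmeasurable step_comp2[of f V "\<lambda>x A. x \<notin> A"])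

lemma HM_subbasic_altdef:
  assumes "0 \<le> a" "b \<le> 1"
  shows "HM_subbasic X U a b \<epsilon> =
    HM_nbhd X (\<lambda>t. if t \<in> {a..<b} then U else UNIV) \<epsilon>"
proof -
  have "{a..<b} - {t \<in> {0..<1}. f t \<in> U} =
      {t \<in> {0..<1}. f t \<notin> (if t \<in> {a..<b} then U else UNIV)}" for f
    using assms by auto
  then show ?thesis unfolding HM_subbasic_def HM_nbhd_def by auto
qed

lemma HM_nbhd_mono:
  assumes "step V" "\<And>t. t \<in> {0..<1} \<Longrightarrow> V' t \<subseteq> V t" "step V'" "\<delta>' \<le> \<delta>"
  shows "HM_nbhd X V' \<delta>' \<subseteq> HM_nbhd X V \<delta>"
proof
  fix f assume f: "f \<in> HM_nbhd X V' \<delta>'"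
  then have "measure lebesgue {t \<in> {0..<1}. f t \<notin> V t} \<le> measure lebesgue {t \<in> {0..<1}. f t \<notin> V' t}"
    using assms by (intro measure_mono_fmeasurable fmeasurableD bad_set_lmeasurable)
      (auto simp: HM_nbhd_def HM_carrier_step)
  then show "f \<in> HM_nbhd X V \<delta>" using f assms unfolding HM_nbhd_def by auto
qed

text \<open>Where \<open>f\<close> already misses \<open>V\<close> no condition is imposed any more; this consumes the measure
  of that set from the budget \<open>\<delta>\<close>.\<close>

lemma HM_nbhd_absorb:
  assumes X: "topspace T = carrier X"
    and V: "step V" "\<And>t. t \<in> {0..<1} \<Longrightarrow> f t \<in> V t \<Longrightarrow> openin T (V t)"
    and f: "f \<in> HM_nbhd X V \<delta>"
  obtains V' \<delta>' where "open_step_cover T f V'" "0 < \<delta>'" "HM_nbhd X V' \<delta>' \<subseteq> HM_nbhd X V \<delta>"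
proof
  have fc: "f \<in> carrier (HM X)" and fs: "step f"
    using f by (auto simp: HM_nbhd_def HM_carrier_step)
  \<comment> \<open>\<open>topspace T\<close> rather than \<open>UNIV\<close> expresses the absence
    of a condition, because an \<open>open_step_cover\<close> must have open values.\<close>
  define V' where "V' t = (if f t \<in> V t then V t else topspace T)" for t
  define \<beta> where "\<beta> = measure lebesgue {t \<in> {0..<1}. f t \<notin> V t}"
  have V's: "step V'"
    unfolding V'_def by (rule step_comp2[OF fs V(1)])
  then show "open_step_cover T f V'"
    using V fc HM_carrier_in[OF fc] unfolding open_step_cover_def V'_def X[symmetric] by simp
  show "0 < \<delta> - \<beta>" using f unfolding HM_nbhd_def \<beta>_def by simp
  show "HM_nbhd X V' (\<delta> - \<beta>) \<subseteq> HM_nbhd X V \<delta>"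
  proof
    fix g assume g: "g \<in> HM_nbhd X V' (\<delta> - \<beta>)"
    then have gc: "g \<in> carrier (HM X)" by (simp add: HM_nbhd_def)
    have "{t \<in> {0..<1}. g t \<notin> V t} \<subseteq> {t \<in> {0..<1}. g t \<notin> V' t} \<union> {t \<in> {0..<1}. f t \<notin> V t}"
      unfolding V'_def by auto
    then have "measure lebesgue {t \<in> {0..<1}. g t \<notin> V t}
        \<le> measure lebesgue ({t \<in> {0..<1}. g t \<notin> V' t} \<union> {t \<in> {0..<1}. f t \<notin> V t})"
      using gc fs V V's HM_carrier_step[OF gc]
      by (intro measure_mono_fmeasurable fmeasurableD bad_set_lmeasurable fmeasurable.Un)
    also have "\<dots> \<le> measure lebesgue {t \<in> {0..<1}. g t \<notin> V' t} + \<beta>"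
      unfolding \<beta>_def using fs V V's HM_carrier_step[OF gc]
      by (intro measure_Un_le fmeasurableD bad_set_lmeasurable)
    also have "\<dots> < \<delta>" using g by (simp add: HM_nbhd_def)
    finally show "g \<in> HM_nbhd X V \<delta>" using gc by (simp add: HM_nbhd_def)
  qed
qed

lemma openin_HM_subbasic:
  assumes "openin T U" "0 \<le> a" "a < b" "b \<le> 1" "0 < \<epsilon>"
  shows "openin (HM_topology X T) (HM_subbasic X U a b \<epsilon>)"
proof -
  have "HM_subbasic X U a b \<epsilon> \<in>
      {HM_subbasic X U a b \<epsilon> | U a b \<epsilon>. openin T U \<and> 0 \<le> a \<and> a < b \<and> b \<le> 1 \<and> 0 < \<epsilon>}"
    using assms by (intro CollectI exI conjI) (rule refl)
  then show ?thesis unfolding HM_topology_def by (rule topology_generated_by_Basis)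
qed

text \<open>Only subbasic sets are known to be open at this stage. One of them is imposed with error
  \<delta>/n on each of the n pieces where V is constant, and the errors add up to less than
  \<delta>.\<close>

lemma HM_nbhd_contains_open:
  assumes f: "f \<in> carrier (HM X)" and V: "open_step_cover T f V" and "0 < \<delta>"
  obtains W where "openin (HM_topology X T) W" "f \<in> W" "W \<subseteq> HM_nbhd X V \<delta>"
proof -
  have Vs: "step V" using V by (simp add: open_step_cover_def)
  obtain n a where part: "unit_partition n a"
    and a: "\<And>i t. i < n \<Longrightarrow> t \<in> {a i..<a (Suc i)} \<Longrightarrow> V t = V (a i)"
    using step_imp_partition[OF Vs] by blast
  \<comment> \<open>This guarantees that \<delta>/n is positive and that the intersection formed
    below is not over an empty family.\<close>
  have n: "n > 0" using part by (cases n) (auto simp: unit_partition_def)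
  define N where "N i = HM_subbasic X (V (a i)) (a i) (a (Suc i)) (\<delta> / n)" for i
  have ai: "a i \<in> {0..<1}" if "i < n" for i using unit_partition_subset[OF part that] by auto
  have "openin (HM_topology X T) (N i)" if "i < n" for i
  proof -
    have "openin T (V (a i))" using V ai[OF that] by (simp add: open_step_cover_def)
    moreover have "0 < \<delta> / n" using n \<open>0 < \<delta>\<close> by simp
    ultimately show ?thesis
      unfolding N_def by (intro openin_HM_subbasic unit_partition_subset[OF part that])
  qed
  then have op: "openin (HM_topology X T) (\<Inter>i\<in>{..<n}. N i)"
    using n by (intro openin_Inter) auto
  moreover have "f \<in> N i" if "i < n" for i
  proof -
    have "t \<in> {0..<1}" "f t \<in> V (a i)" if t: "t \<in> {a i..<a (Suc i)}" for t
    proof -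
      show t01: "t \<in> {0..<1}" using unit_partition_subset(4)[OF part \<open>i < n\<close>] t by blast
      have "f t \<in> V t" using V t01 by (simp only: open_step_cover_def)
      then show "f t \<in> V (a i)" using a[OF \<open>i < n\<close> t] by (simp only:)
    qed
    then have "{a i..<a (Suc i)} - {t \<in> {0..<1}. f t \<in> V (a i)} = {}" by blast
    then have "measure lebesgue ({a i..<a (Suc i)} - {t \<in> {0..<1}. f t \<in> V (a i)}) = 0"
      by (simp only: measure_empty)
    then show ?thesis unfolding N_def HM_subbasic_def using f n \<open>0 < \<delta>\<close> by simp
  qed
  moreover have "(\<Inter>i\<in>{..<n}. N i) \<subseteq> HM_nbhd X V \<delta>"
  proof
    fix g assume g: "g \<in> (\<Inter>i\<in>{..<n}. N i)"
    then have gc: "g \<in> carrier (HM X)" using n by (auto simp: N_def HM_subbasic_def)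
    define B where "B i = {a i..<a (Suc i)} - {t \<in> {0..<1}. g t \<in> V (a i)}" for i
    have meas: "B i \<in> lmeasurable" for i
      unfolding B_def using HM_carrier_step[OF gc]
      by (intro fmeasurable_Diff fmeasurableD[OF step_lmeasurable] step_comp[of g "\<lambda>x. x \<in> V (a i)"]
        bounded_set_imp_lmeasurable) auto
    have "measure lebesgue {t \<in> {0..<1}. g t \<notin> V t} \<le> measure lebesgue (\<Union>i\<in>{..<n}. B i)"
    proof (intro measure_mono_fmeasurable fmeasurableD fmeasurable.finite_UN)
      show "{t \<in> {0..<1}. g t \<notin> V t} \<subseteq> (\<Union>i\<in>{..<n}. B i)"
      proof
        fix t assume t: "t \<in> {t \<in> {0..<1}. g t \<notin> V t}"
        then have "t \<in> {0..<1}" by simp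
        then obtain i where "i < n" "t \<in> {a i..<a (Suc i)}"
          by (rule unit_partition_cover[OF part])
        moreover from this have "g t \<notin> V (a i)" using t a[of i t] by simp
        ultimately show "t \<in> (\<Union>i\<in>{..<n}. B i)" unfolding B_def by blast
      qed
    qed (use meas bad_set_lmeasurable[OF HM_carrier_step[OF gc] Vs] in auto)
    also have "\<dots> \<le> (\<Sum>i<n. measure lebesgue (B i))"
      using meas by (intro measure_UNION_le) auto
    also have "\<dots> < (\<Sum>i<n. \<delta> / n)"
      using g n by (intro sum_strict_mono) (auto simp: N_def HM_subbasic_def B_def)
    also have "\<dots> = \<delta>" using n by simp
    finally show "g \<in> HM_nbhd X V \<delta>" using gc by (simp add: HM_nbhd_def)
  qed
  ultimately show thesis using that by blast
qed

lemma topspace_HM: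
  assumes "topspace T = carrier X"
  shows "topspace (HM_topology X T) = carrier (HM X)"
proof -
  let ?\<B> = "{HM_subbasic X U a b \<epsilon> | U a b \<epsilon>. openin T U \<and> 0 \<le> a \<and> a < b \<and> b \<le> 1 \<and> 0 < \<epsilon>}"
  have "\<Union>?\<B> \<subseteq> carrier (HM X)" unfolding HM_subbasic_def by auto
  \<comment> \<open>With U the whole space no argument is exceptional, so any positive bound gives
    all of \<open>HM X\<close>; the value 2 is arbitrary.\<close>
  moreover have "carrier (HM X) \<subseteq> HM_subbasic X (topspace T) 0 1 2"
  proof
    fix f assume f: "f \<in> carrier (HM X)"
    have "{0..<1} - {t \<in> {0..<1}. f t \<in> topspace T} = {}"
      using HM_carrier_in[OF f] assms by auto
    then have "measure lebesgue ({0..<1} - {t \<in> {0..<1}. f t \<in> topspace T}) = 0"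
      by (simp only: measure_empty)
    then show "f \<in> HM_subbasic X (topspace T) 0 1 2"
      unfolding HM_subbasic_def using f by simp
  qed
  moreover have "HM_subbasic X (topspace T) 0 1 2 \<in> ?\<B>" by force
  ultimately show ?thesis unfolding HM_topology_def topology_generated_by_topspace by blast
qed

text \<open>A subbasic set tolerates arguments t with f t \<notin> U, so it is not immediately a
  neighborhood of the required form at f; \<open>HM_nbhd_absorb\<close> repairs this. For finite
  intersections the covers are intersected pointwise and the smaller \<delta> is taken.\<close>

lemma openin_HM_iff:
  assumes X: "topspace T = carrier X"
  shows "openin (HM_topology X T) W \<longleftrightarrow> W \<subseteq> carrier (HM X) \<and>
    (\<forall>f\<in>W. \<exists>V \<delta>. open_step_cover T f V \<and> 0 < \<delta> \<and> HM_nbhd X V \<delta> \<subseteq> W)" (is "_ \<longleftrightarrow> ?R W")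
proof
  assume W: "openin (HM_topology X T) W"
  have "\<forall>f\<in>W. \<exists>V \<delta>. open_step_cover T f V \<and> 0 < \<delta> \<and> HM_nbhd X V \<delta> \<subseteq> W"
    using W[unfolded HM_topology_def openin_topology_generated_by_iff]
  proof induction
    case (Int W1 W2)
    show ?case
    proof
      fix f assume "f \<in> W1 \<inter> W2"
      then obtain V1 \<delta>1 V2 \<delta>2 where
        1: "open_step_cover T f V1" "0 < \<delta>1" "HM_nbhd X V1 \<delta>1 \<subseteq> W1" and
        2: "open_step_cover T f V2" "0 < \<delta>2" "HM_nbhd X V2 \<delta>2 \<subseteq> W2"
        using Int.IH by (meson IntD1 IntD2)
      have s: "step V1" "step V2" "step (\<lambda>t. V1 t \<inter> V2 t)"
        using 1(1) 2(1) by (auto simp: open_step_cover_def intro: step_comp2)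
      have "open_step_cover T f (\<lambda>t. V1 t \<inter> V2 t)"
        using 1 2 s by (auto simp: open_step_cover_def)
      moreover have "HM_nbhd X (\<lambda>t. V1 t \<inter> V2 t) (min \<delta>1 \<delta>2) \<subseteq> W1 \<inter> W2"
        using 1(3) 2(3) s HM_nbhd_mono[of V1 "\<lambda>t. V1 t \<inter> V2 t" "min \<delta>1 \<delta>2" \<delta>1 X]
          HM_nbhd_mono[of V2 "\<lambda>t. V1 t \<inter> V2 t" "min \<delta>1 \<delta>2" \<delta>2 X] by force
      ultimately show "\<exists>V \<delta>. open_step_cover T f V \<and> 0 < \<delta> \<and> HM_nbhd X V \<delta> \<subseteq> W1 \<inter> W2"
        using 1(2) 2(2) by (metis min_less_iff_conj)
    qed
  next
    case (UN K)
    then show ?case by (meson UnionE Union_upper order_trans)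
  next
    case (Basis N)
    then obtain U a b \<epsilon> where N: "N = HM_subbasic X U a b \<epsilon>" "openin T U" "0 \<le> a" "b \<le> 1" by auto
    \<comment> \<open>Both step functions describe the same subbasic set, because elements of
      \<open>HM X\<close> take values in \<open>topspace T\<close>; only this one has open
      values.\<close>
    let ?V = "\<lambda>t. if t \<in> {a..<b} then U else topspace T"
    let ?V' = "\<lambda>t. if t \<in> {a..<b} then U else UNIV"
    have eq: "N = HM_nbhd X ?V \<epsilon>"
    proof -
      have e: "{t \<in> {0..<1}. f t \<notin> ?V' t} = {t \<in> {0..<1}. f t \<notin> ?V t}" if "f \<in> carrier (HM X)" for f
        using HM_carrier_in[OF that] X by auto
      show ?thesis unfolding N(1) HM_subbasic_altdef[OF N(3,4)] HM_nbhd_def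
        by (intro Collect_cong conj_cong refl) (simp only: e)
    qed
    have s: "step ?V" by (rule step_comp[OF step_interval])
    show ?case
    proof
      fix f assume "f \<in> N"
      then have f: "f \<in> HM_nbhd X ?V \<epsilon>" unfolding eq .
      have "openin T (?V t)" if "t \<in> {0..<1}" "f t \<in> ?V t" for t using N(2) by simp
      from this f obtain V' \<delta>' where "open_step_cover T f V'" "0 < \<delta>'" "HM_nbhd X V' \<delta>' \<subseteq> N"
        unfolding eq by (rule HM_nbhd_absorb[OF X s])
      then show "\<exists>V \<delta>. open_step_cover T f V \<and> 0 < \<delta> \<and> HM_nbhd X V \<delta> \<subseteq> N" by blast
    qed
  qed simp
  then show "?R W" using openin_subset[OF W] topspace_HM[OF X] by simp
next
  assume R: "?R W"
  show "openin (HM_topology X T) W"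
  proof (subst openin_subopen, intro ballI)
    fix f assume "f \<in> W"
    then obtain V \<delta> where "open_step_cover T f V" "0 < \<delta>" "HM_nbhd X V \<delta> \<subseteq> W" "f \<in> carrier (HM X)"
      using R by blast
    then show "\<exists>U. openin (HM_topology X T) U \<and> f \<in> U \<and> U \<subseteq> W"
      by (meson HM_nbhd_contains_open order_trans)
  qed
qed

section \<open>The topological group \<open>HM0 X\<close>\<close>

lemma HM0_carrier_iff: "f \<in> carrier (HM0 X) \<longleftrightarrow> f \<in> carrier (HM X) \<and> f 0 = \<one>\<^bsub>X\<^esub>"
  by (simp add: HM0_def)

lemma HM0_mult: "f \<otimes>\<^bsub>HM0 X\<^esub> g = (\<lambda>t\<in>{0..<1}. f t \<otimes>\<^bsub>X\<^esub> g t)"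
  by (simp add: HM0_def HM_def)

lemma HM0_one: "\<one>\<^bsub>HM0 X\<^esub> = (\<lambda>t\<in>{0..<1}. \<one>\<^bsub>X\<^esub>)"
  by (simp add: HM0_def HM_def)

lemma HM_carrierI:
  assumes "step f" "\<And>t. t \<in> {0..<1} \<Longrightarrow> f t \<in> carrier X"
  shows "(\<lambda>t\<in>{0..<1}. f t) \<in> carrier (HM X)"
  using assms step_cong[OF assms(1), of "\<lambda>t\<in>{0..<1}. f t"] by (auto simp: HM_carrier_iff)

lemma HM_ext:
  assumes "f \<in> carrier (HM X)" "g \<in> extensional {0..<1}" "\<And>t. t \<in> {0..<1} \<Longrightarrow> f t = g t"
  shows "f = g"
proof (rule extensionalityI[OF _ assms(2,3)])
  show "f \<in> extensional {0..<1}" using assms(1) by (auto simp: HM_carrier_iff PiE_def)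
qed

lemma HM0_in: "f \<in> carrier (HM0 X) \<Longrightarrow> t \<in> {0..<1} \<Longrightarrow> f t \<in> carrier X"
  by (simp add: HM0_carrier_iff HM_carrier_in)

lemma HM0_step: "f \<in> carrier (HM0 X) \<Longrightarrow> step f"
  unfolding HM0_carrier_iff by (blast dest: HM_carrier_step)

lemma openin_HM0_iff:
  assumes X: "topspace T = carrier X"
  shows "openin (HM0_topology X T) W \<longleftrightarrow> W \<subseteq> carrier (HM0 X) \<and>
    (\<forall>f\<in>W. \<exists>V \<delta>. open_step_cover T f V \<and> 0 < \<delta> \<and> HM_nbhd X V \<delta> \<inter> carrier (HM0 X) \<subseteq> W)"
    (is "_ \<longleftrightarrow> ?R W")
proof
  assume "openin (HM0_topology X T) W"
  then obtain W' where W': "openin (HM_topology X T) W'" "W = W' \<inter> carrier (HM0 X)"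
    by (auto simp: HM0_topology_def openin_subtopology)
  then have "\<forall>f\<in>W'. \<exists>V \<delta>. open_step_cover T f V \<and> 0 < \<delta> \<and> HM_nbhd X V \<delta> \<subseteq> W'"
    by (simp add: openin_HM_iff[OF X])
  then show "?R W" unfolding W'(2) by (meson IntD1 Int_lower2 Int_mono order_refl)
next
  assume R: "?R W"
  show "openin (HM0_topology X T) W"
  proof (subst openin_subopen, intro ballI)
    fix f assume f: "f \<in> W"
    then obtain V \<delta> where V: "open_step_cover T f V" "0 < \<delta>" "HM_nbhd X V \<delta> \<inter> carrier (HM0 X) \<subseteq> W"
      using R by blast
    have f0: "f \<in> carrier (HM X)" "f \<in> carrier (HM0 X)" using f R by (auto simp: HM0_carrier_iff)
    obtain O' where "openin (HM_topology X T) O'" "f \<in> O'" "O' \<subseteq> HM_nbhd X V \<delta>"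
      by (rule HM_nbhd_contains_open[OF f0(1) V(1,2)])
    then have "openin (HM0_topology X T) (O' \<inter> carrier (HM0 X)) \<and> f \<in> O' \<inter> carrier (HM0 X)
        \<and> O' \<inter> carrier (HM0 X) \<subseteq> W"
      using V(3) f0 by (auto simp: HM0_topology_def openin_subtopology)
    then show "\<exists>U. openin (HM0_topology X T) U \<and> f \<in> U \<and> U \<subseteq> W" by blast
  qed
qed

lemma topspace_HM0:
  assumes "topspace T = carrier X"
  shows "topspace (HM0_topology X T) = carrier (HM0 X)"
  unfolding HM0_topology_def topspace_subtopology topspace_HM[OF assms]
  using HM0_carrier_iff[of _ X] by blast

lemma HM0_nbhd_contains_open:
  assumes X: "topspace T = carrier X"
    and f: "f \<in> carrier (HM0 X)" and V: "open_step_cover T f V" "0 < \<delta>"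
  obtains W where "openin (HM0_topology X T) W" "f \<in> W" "W \<subseteq> HM_nbhd X V \<delta>" "W \<subseteq> carrier (HM0 X)"
proof -
  have "f \<in> carrier (HM X)" using f by (simp add: HM0_carrier_iff)
  then obtain O' where O': "openin (HM_topology X T) O'" "f \<in> O'" "O' \<subseteq> HM_nbhd X V \<delta>"
    by (rule HM_nbhd_contains_open[OF _ V])
  show thesis
  proof (rule that)
    show "openin (HM0_topology X T) (O' \<inter> carrier (HM0 X))"
      using O'(1) by (auto simp: HM0_topology_def openin_subtopology)
  qed (use O' f in auto)
qed

text \<open>Continuity in epsilon-delta form. It serves inversion and changes of the argument;
  multiplication starts from a product space and is treated directly.\<close>

lemma continuous_map_HM0I:
  assumes X: "topspace T = carrier X" "topspace T' = carrier X'"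
    and F: "\<And>f. f \<in> carrier (HM0 X) \<Longrightarrow> F f \<in> carrier (HM0 X')"
    and nbhd: "\<And>f V \<delta>. f \<in> carrier (HM0 X) \<Longrightarrow> open_step_cover T' (F f) V \<Longrightarrow> 0 < \<delta> \<Longrightarrow>
      \<exists>V' \<delta>'. open_step_cover T f V' \<and> 0 < \<delta>' \<and>
        (\<forall>g\<in>HM_nbhd X V' \<delta>' \<inter> carrier (HM0 X). F g \<in> HM_nbhd X' V \<delta>)"
  shows "continuous_map (HM0_topology X T) (HM0_topology X' T') F"
  unfolding continuous_map_def topspace_HM0[OF X(1)] topspace_HM0[OF X(2)]
proof (intro conjI allI impI)
  show "F \<in> carrier (HM0 X) \<rightarrow> carrier (HM0 X')" using F by blast
  fix W assume W: "openin (HM0_topology X' T') W"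
  show "openin (HM0_topology X T) {f \<in> carrier (HM0 X). F f \<in> W}"
    unfolding openin_HM0_iff[OF X(1)]
  proof (intro conjI ballI)
    fix f assume "f \<in> {f \<in> carrier (HM0 X). F f \<in> W}"
    then have f: "f \<in> carrier (HM0 X)" "F f \<in> W" by auto
    then obtain V \<delta> where V: "open_step_cover T' (F f) V" "0 < \<delta>"
        "HM_nbhd X' V \<delta> \<inter> carrier (HM0 X') \<subseteq> W"
      using W[unfolded openin_HM0_iff[OF X(2)]] by blast
    from nbhd[OF f(1) V(1,2)] obtain V' \<delta>' where V': "open_step_cover T f V'" "0 < \<delta>'"
        "\<forall>g\<in>HM_nbhd X V' \<delta>' \<inter> carrier (HM0 X). F g \<in> HM_nbhd X' V \<delta>" by blast
    have "HM_nbhd X V' \<delta>' \<inter> carrier (HM0 X) \<subseteq> {f \<in> carrier (HM0 X). F f \<in> W}"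
      using V'(3) V(3) F by blast
    then show "\<exists>V \<delta>. open_step_cover T f V \<and> 0 < \<delta> \<and>
        HM_nbhd X V \<delta> \<inter> carrier (HM0 X) \<subseteq> {f \<in> carrier (HM0 X). F f \<in> W}"
      using V' by blast
  qed blast
qed

section \<open>Continuity of the group operations on \<open>HM0 X\<close>\<close>

context
  fixes X :: "('a, 'b) monoid_scheme" and T :: "'a topology"
  assumes TG: "topological_group X T"
begin

lemma X_group: "group X"
  and X_top: "topspace T = carrier X"
  and X_mult: "continuous_map (prod_topology T T) T (\<lambda>(x, y). x \<otimes>\<^bsub>X\<^esub> y)"
  and X_inv: "continuous_map T T (\<lambda>x. inv\<^bsub>X\<^esub> x)"
  using TG by (simp_all add: topological_group_def)

interpretation X: group X by (rule X_group)

lemma HM0_mult_closed: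
  assumes "f \<in> carrier (HM0 X)" "g \<in> carrier (HM0 X)"
  shows "f \<otimes>\<^bsub>HM0 X\<^esub> g \<in> carrier (HM0 X)"
proof -
  have "(\<lambda>t\<in>{0..<1}. f t \<otimes>\<^bsub>X\<^esub> g t) \<in> carrier (HM X)"
    by (rule HM_carrierI[OF step_comp2[OF HM0_step[OF assms(1)] HM0_step[OF assms(2)]]])
      (use assms HM0_in in blast)
  then show ?thesis using assms by (simp add: HM0_mult HM0_carrier_iff)
qed

lemma HM0_inv_closed:
  assumes "f \<in> carrier (HM0 X)"
  shows "(\<lambda>t\<in>{0..<1}. inv\<^bsub>X\<^esub> f t) \<in> carrier (HM0 X)"
proof -
  have "(\<lambda>t\<in>{0..<1}. inv\<^bsub>X\<^esub> f t) \<in> carrier (HM X)"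
    by (rule HM_carrierI[OF step_comp[OF HM0_step[OF assms(1)]]])
      (use assms HM0_in in blast)
  then show ?thesis using assms by (simp add: HM0_carrier_iff)
qed

lemma HM0_one_closed: "\<one>\<^bsub>HM0 X\<^esub> \<in> carrier (HM0 X)"
  using HM_carrierI[OF step_const, of "\<one>\<^bsub>X\<^esub>" X] by (simp add: HM0_one HM0_carrier_iff)

lemma HM0_l_inv:
  assumes "f \<in> carrier (HM0 X)"
  shows "(\<lambda>t\<in>{0..<1}. inv\<^bsub>X\<^esub> f t) \<otimes>\<^bsub>HM0 X\<^esub> f = \<one>\<^bsub>HM0 X\<^esub>"
  using HM0_in[OF assms] by (auto simp: HM0_mult HM0_one intro!: restrict_ext)

lemma group_HM0: "group (HM0 X)"
proof (rule groupI)
  fix f g h assume f: "f \<in> carrier (HM0 X)" and g: "g \<in> carrier (HM0 X)"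
  show "f \<otimes>\<^bsub>HM0 X\<^esub> g \<in> carrier (HM0 X)" by (rule HM0_mult_closed[OF f g])
  assume h: "h \<in> carrier (HM0 X)"
  show "f \<otimes>\<^bsub>HM0 X\<^esub> g \<otimes>\<^bsub>HM0 X\<^esub> h = f \<otimes>\<^bsub>HM0 X\<^esub> (g \<otimes>\<^bsub>HM0 X\<^esub> h)"
    using HM0_in[OF f] HM0_in[OF g] HM0_in[OF h]
    by (auto simp: HM0_mult X.m_assoc intro!: restrict_ext)
next
  fix f assume f: "f \<in> carrier (HM0 X)"
  then have "f \<in> carrier (HM X)" by (simp add: HM0_carrier_iff)
  then show "\<one>\<^bsub>HM0 X\<^esub> \<otimes>\<^bsub>HM0 X\<^esub> f = f"
    by (intro HM_ext[symmetric]) (auto simp: HM0_mult HM0_one HM_carrier_in)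
  show "\<exists>g\<in>carrier (HM0 X). g \<otimes>\<^bsub>HM0 X\<^esub> f = \<one>\<^bsub>HM0 X\<^esub>"
    using HM0_inv_closed[OF f] HM0_l_inv[OF f] by blast
qed (rule HM0_one_closed)

lemma HM0_inv:
  assumes "f \<in> carrier (HM0 X)"
  shows "inv\<^bsub>HM0 X\<^esub> f = (\<lambda>t\<in>{0..<1}. inv\<^bsub>X\<^esub> f t)"
  by (intro group.inv_equality[OF group_HM0] HM0_l_inv HM0_inv_closed assms)

text \<open>Inversion acts value by value: pulling V t back under it gives a cover at f, and an
  argument where the inverse of g misses V is one where g misses V', so the same \<delta>
  works.\<close>

lemma continuous_inv_HM0:
  "continuous_map (HM0_topology X T) (HM0_topology X T) (\<lambda>f. inv\<^bsub>HM0 X\<^esub> f)"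
proof (rule continuous_map_HM0I[OF X_top X_top])
  fix f V and \<delta> :: real
  assume f: "f \<in> carrier (HM0 X)" and V: "open_step_cover T (inv\<^bsub>HM0 X\<^esub> f) V" and "0 < \<delta>"
  have Vs: "step V" using V by (simp add: open_step_cover_def)
  define V' where "V' t = {x \<in> topspace T. inv\<^bsub>X\<^esub> x \<in> V t}" for t
  have V's: "step V'" unfolding V'_def using Vs by (rule step_comp)
  have "open_step_cover T f V'"
    unfolding open_step_cover_def
  proof (intro conjI ballI V's)
    fix t :: real assume t: "t \<in> {0..<1}"
    then have "openin T (V t)" "inv\<^bsub>X\<^esub> f t \<in> V t"
      using V unfolding open_step_cover_def HM0_inv[OF f] by auto
    then show "openin T (V' t)" "f t \<in> V' t"
      using openin_continuous_map_preimage[OF X_inv] HM0_in[OF f t] X_top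
      by (simp_all add: V'_def)
  qed
  moreover have "inv\<^bsub>HM0 X\<^esub> g \<in> HM_nbhd X V \<delta>" if "g \<in> HM_nbhd X V' \<delta> \<inter> carrier (HM0 X)" for g
  proof -
    have g: "g \<in> HM_nbhd X V' \<delta>" "g \<in> carrier (HM0 X)" using that by auto
    have ig: "inv\<^bsub>HM0 X\<^esub> g \<in> carrier (HM0 X)" by (rule group.inv_closed[OF group_HM0 g(2)])
    have "measure lebesgue {t \<in> {0..<1}. (inv\<^bsub>HM0 X\<^esub> g) t \<notin> V t}
        \<le> measure lebesgue {t \<in> {0..<1}. g t \<notin> V' t}"
    proof (intro measure_mono_fmeasurable fmeasurableD
        bad_set_lmeasurable[OF HM0_step[OF ig] Vs] bad_set_lmeasurable[OF HM0_step[OF g(2)] V's])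
      show "{t \<in> {0..<1}. (inv\<^bsub>HM0 X\<^esub> g) t \<notin> V t} \<subseteq> {t \<in> {0..<1}. g t \<notin> V' t}"
        using HM0_inv[OF g(2)] by (auto simp: V'_def)
    qed
    then show ?thesis using g(1) ig by (simp add: HM_nbhd_def HM0_carrier_iff)
  qed
  ultimately show "\<exists>V' \<delta>'. open_step_cover T f V' \<and> 0 < \<delta>' \<and>
      (\<forall>g\<in>HM_nbhd X V' \<delta>' \<inter> carrier (HM0 X). inv\<^bsub>HM0 X\<^esub> g \<in> HM_nbhd X V \<delta>)"
    using \<open>0 < \<delta>\<close> by blast
qed (rule group.inv_closed[OF group_HM0])

text \<open>The two neighborhoods are packed into one pair P so that a single use of
  \<open>SOME\<close> can select them together.\<close>

lemma mult_nbhds: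
  assumes "openin T U" "x \<in> carrier X" "y \<in> carrier X" "x \<otimes>\<^bsub>X\<^esub> y \<in> U"
  shows "\<exists>P. openin T (fst P) \<and> openin T (snd P) \<and> x \<in> fst P \<and> y \<in> snd P \<and>
    (\<forall>x'\<in>fst P. \<forall>y'\<in>snd P. x' \<otimes>\<^bsub>X\<^esub> y' \<in> U)"
proof -
  have "openin (prod_topology T T) {z \<in> topspace (prod_topology T T). (case z of (x, y) \<Rightarrow> x \<otimes>\<^bsub>X\<^esub> y) \<in> U}"
    by (rule openin_continuous_map_preimage[OF X_mult assms(1)])
  moreover have "(x, y) \<in> {z \<in> topspace (prod_topology T T). (case z of (x, y) \<Rightarrow> x \<otimes>\<^bsub>X\<^esub> y) \<in> U}"
    using assms X_top by simp
  ultimately obtain A B where AB: "openin T A" "openin T B" "x \<in> A" "y \<in> B"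
      "A \<times> B \<subseteq> {z \<in> topspace (prod_topology T T). (case z of (x, y) \<Rightarrow> x \<otimes>\<^bsub>X\<^esub> y) \<in> U}"
    unfolding openin_prod_topology_alt by meson
  have "x' \<otimes>\<^bsub>X\<^esub> y' \<in> U" if "x' \<in> A" "y' \<in> B" for x' y'
    using subsetD[OF AB(5), of "(x', y')"] that by simp
  then show ?thesis using AB(1-4) by (intro exI[of _ "(A, B)"]) simp
qed

text \<open>The two factors are chosen as a function of the triple \<open>(f t, g t, V t)\<close> alone, so that they
  inherit from \<open>f\<close>, \<open>g\<close> and \<open>V\<close> the property of being step functions of \<open>t\<close>.\<close>

lemma HM0_mult_nbhds:
  assumes f: "f \<in> carrier (HM0 X)" and g: "g \<in> carrier (HM0 X)"
    and V: "open_step_cover T (f \<otimes>\<^bsub>HM0 X\<^esub> g) V"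
  obtains A B where "open_step_cover T f A" "open_step_cover T g B"
    "\<And>t x y. t \<in> {0..<1} \<Longrightarrow> x \<in> A t \<Longrightarrow> y \<in> B t \<Longrightarrow> x \<otimes>\<^bsub>X\<^esub> y \<in> V t"
proof -
  define Q where "Q x y U P \<longleftrightarrow> openin T (fst P) \<and> openin T (snd P) \<and> x \<in> fst P \<and> y \<in> snd P \<and>
    (\<forall>x'\<in>fst P. \<forall>y'\<in>snd P. x' \<otimes>\<^bsub>X\<^esub> y' \<in> U)" for x y U P
  define P where "P x y U = (SOME P. Q x y U P)" for x y U
  have P: "Q (f t) (g t) (V t) (P (f t) (g t) (V t))" if t: "t \<in> {0..<1}" for t
  proof -
    have "openin T (V t)" "f t \<otimes>\<^bsub>X\<^esub> g t \<in> V t"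
      using V t by (auto simp: open_step_cover_def HM0_mult)
    then have "\<exists>P. Q (f t) (g t) (V t) P"
      unfolding Q_def using mult_nbhds HM0_in[OF f t] HM0_in[OF g t] by blast
    then show ?thesis unfolding P_def by (rule someI_ex)
  qed
  have "step V" using V by (simp add: open_step_cover_def)
  then have "step (\<lambda>t. (f t, g t, V t))"
    by (intro step_Pair HM0_step[OF f] HM0_step[OF g])
  from step_comp[OF this, of "\<lambda>(x, y, U). P x y U"]
  have Ps: "step (\<lambda>t. P (f t) (g t) (V t))" by simp
  show thesis
  proof (rule that)
    show "open_step_cover T f (\<lambda>t. fst (P (f t) (g t) (V t)))"
      using step_comp[OF Ps, of fst] P by (simp add: open_step_cover_def Q_def)
    show "open_step_cover T g (\<lambda>t. snd (P (f t) (g t) (V t)))"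
      using step_comp[OF Ps, of snd] P by (simp add: open_step_cover_def Q_def)
  qed (use P in \<open>simp add: Q_def\<close>)
qed

text \<open>A product misses V t only where one of the factors misses its own neighborhood, so each
  factor is allotted \<delta>/2.\<close>

lemma continuous_mult_HM0:
  "continuous_map (prod_topology (HM0_topology X T) (HM0_topology X T)) (HM0_topology X T)
     (\<lambda>(f, g). f \<otimes>\<^bsub>HM0 X\<^esub> g)"
  unfolding continuous_map_def topspace_prod_topology topspace_HM0[OF X_top]
proof (intro conjI allI impI)
  show "(\<lambda>(f, g). f \<otimes>\<^bsub>HM0 X\<^esub> g) \<in> carrier (HM0 X) \<times> carrier (HM0 X) \<rightarrow> carrier (HM0 X)"
    using HM0_mult_closed by auto
  fix W assume W: "openin (HM0_topology X T) W"
  show "openin (prod_topology (HM0_topology X T) (HM0_topology X T))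
      {z \<in> carrier (HM0 X) \<times> carrier (HM0 X). (case z of (f, g) \<Rightarrow> f \<otimes>\<^bsub>HM0 X\<^esub> g) \<in> W}"
    unfolding openin_prod_topology_alt
  proof (intro allI impI)
    fix f g assume "(f, g) \<in> {z \<in> carrier (HM0 X) \<times> carrier (HM0 X). (case z of (f, g) \<Rightarrow> f \<otimes>\<^bsub>HM0 X\<^esub> g) \<in> W}"
    then have f: "f \<in> carrier (HM0 X)" and g: "g \<in> carrier (HM0 X)" and fg: "f \<otimes>\<^bsub>HM0 X\<^esub> g \<in> W"
      by auto
    from fg obtain V \<delta> where V: "open_step_cover T (f \<otimes>\<^bsub>HM0 X\<^esub> g) V" "0 < \<delta>"
        "HM_nbhd X V \<delta> \<inter> carrier (HM0 X) \<subseteq> W"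
      using W[unfolded openin_HM0_iff[OF X_top]] by blast
    obtain A B where A: "open_step_cover T f A" and B: "open_step_cover T g B"
      and AB: "\<And>t x y. t \<in> {0..<1} \<Longrightarrow> x \<in> A t \<Longrightarrow> y \<in> B t \<Longrightarrow> x \<otimes>\<^bsub>X\<^esub> y \<in> V t"
      by (rule HM0_mult_nbhds[OF f g V(1)]) blast
    have s: "step V" "step A" "step B" using V(1) A B by (auto simp: open_step_cover_def)
    have half: "0 < \<delta> / 2" using V(2) by simp
    obtain W1 where W1: "openin (HM0_topology X T) W1" "f \<in> W1" "W1 \<subseteq> HM_nbhd X A (\<delta>/2)" "W1 \<subseteq> carrier (HM0 X)"
      by (rule HM0_nbhd_contains_open[OF X_top f A half])
    obtain W2 where W2: "openin (HM0_topology X T) W2" "g \<in> W2" "W2 \<subseteq> HM_nbhd X B (\<delta>/2)" "W2 \<subseteq> carrier (HM0 X)"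
      by (rule HM0_nbhd_contains_open[OF X_top g B half])
    have prod_in: "f' \<otimes>\<^bsub>HM0 X\<^esub> g' \<in> W" if f': "f' \<in> W1" and g': "g' \<in> W2" for f' g'
    proof -
      have c: "f' \<in> carrier (HM0 X)" "g' \<in> carrier (HM0 X)" using f' g' W1 W2 by auto
      note p = HM0_mult_closed[OF c]
      note bad = bad_set_lmeasurable[OF HM0_step[OF c(1)] s(2)] bad_set_lmeasurable[OF HM0_step[OF c(2)] s(3)]
        bad_set_lmeasurable[OF HM0_step[OF p] s(1)]
      have "measure lebesgue {t \<in> {0..<1}. (f' \<otimes>\<^bsub>HM0 X\<^esub> g') t \<notin> V t}
          \<le> measure lebesgue ({t \<in> {0..<1}. f' t \<notin> A t} \<union> {t \<in> {0..<1}. g' t \<notin> B t})"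
      proof (intro measure_mono_fmeasurable fmeasurableD fmeasurable.Un bad)
        show "{t \<in> {0..<1}. (f' \<otimes>\<^bsub>HM0 X\<^esub> g') t \<notin> V t}
            \<subseteq> {t \<in> {0..<1}. f' t \<notin> A t} \<union> {t \<in> {0..<1}. g' t \<notin> B t}"
          using AB by (auto simp: HM0_mult)
      qed
      also have "\<dots> \<le> measure lebesgue {t \<in> {0..<1}. f' t \<notin> A t} + measure lebesgue {t \<in> {0..<1}. g' t \<notin> B t}"
        by (intro measure_Un_le fmeasurableD bad)
      also have "\<dots> < \<delta>"
        using subsetD[OF W1(3) f'] subsetD[OF W2(3) g'] by (simp add: HM_nbhd_def)
      finally have "f' \<otimes>\<^bsub>HM0 X\<^esub> g' \<in> HM_nbhd X V \<delta>"
        using p by (simp add: HM_nbhd_def HM0_carrier_iff)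
      then show ?thesis using V(3) p by blast
    qed
    show "\<exists>U1 U2. openin (HM0_topology X T) U1 \<and> openin (HM0_topology X T) U2 \<and> f \<in> U1 \<and> g \<in> U2 \<and>
        U1 \<times> U2 \<subseteq> {z \<in> carrier (HM0 X) \<times> carrier (HM0 X). (case z of (f, g) \<Rightarrow> f \<otimes>\<^bsub>HM0 X\<^esub> g) \<in> W}"
    proof (intro exI conjI)
      show "W1 \<times> W2 \<subseteq> {z \<in> carrier (HM0 X) \<times> carrier (HM0 X). (case z of (f, g) \<Rightarrow> f \<otimes>\<^bsub>HM0 X\<^esub> g) \<in> W}"
        using prod_in W1(4) W2(4) by auto
    qed (use W1 W2 in auto)
  qed
qed

lemma topological_group_HM0: "topological_group (HM0 X) (HM0_topology X T)"
  unfolding topological_group_def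
  using group_HM0 topspace_HM0[OF X_top] continuous_mult_HM0 continuous_inv_HM0 by blast

end

section \<open>Semidirect products with the integers\<close>

text \<open>Over a discrete second factor the preimage of an open set is a union of open slices, so
  continuity of each \<open>F n\<close> already gives joint continuity.\<close>

lemma continuous_map_discrete_family:
  assumes "\<And>n. continuous_map T T' (F n)"
  shows "continuous_map (prod_topology T (discrete_topology UNIV)) T' (\<lambda>(x, n). F n x)"
  unfolding continuous_map_def
proof (intro conjI allI impI)
  show "(\<lambda>(x, n). F n x) \<in> topspace (prod_topology T (discrete_topology UNIV)) \<rightarrow> topspace T'"
    using assms by (auto simp: continuous_map_def)
  fix W assume W: "openin T' W"
  have eq: "{z \<in> topspace (prod_topology T (discrete_topology UNIV)). (case z of (x, n) \<Rightarrow> F n x) \<in> W}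
      = (\<Union>n. {x \<in> topspace T. F n x \<in> W} \<times> {n})"
    by auto
  have "openin (prod_topology T (discrete_topology UNIV)) ({x \<in> topspace T. F n x \<in> W} \<times> {n})" for n
    using openin_continuous_map_preimage[OF assms W, of n] by (simp add: openin_prod_Times_iff)
  then show "openin (prod_topology T (discrete_topology UNIV))
      {z \<in> topspace (prod_topology T (discrete_topology UNIV)). (case z of (x, n) \<Rightarrow> F n x) \<in> W}"
    unfolding eq by (intro openin_Union) blast
qed

lemma carrier_AutoGroup: "carrier (AutoGroup Y) = auto Y"
  by (simp add: AutoGroup_def)

lemma mult_AutoGroup:
  assumes "f \<in> auto Y" "g \<in> auto Y" "x \<in> carrier Y"
  shows "(f \<otimes>\<^bsub>AutoGroup Y\<^esub> g) x = f (g x)"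
  using assms by (simp add: AutoGroup_def BijGroup_def auto_def compose_def)

lemma one_AutoGroup: "x \<in> carrier Y \<Longrightarrow> \<one>\<^bsub>AutoGroup Y\<^esub> x = x"
  by (simp add: AutoGroup_def BijGroup_def)

lemma auto_closed: "f \<in> auto Y \<Longrightarrow> x \<in> carrier Y \<Longrightarrow> f x \<in> carrier Y"
  by (auto simp: auto_def hom_def)

lemma auto_mult:
  "f \<in> auto Y \<Longrightarrow> x \<in> carrier Y \<Longrightarrow> y \<in> carrier Y \<Longrightarrow> f (x \<otimes>\<^bsub>Y\<^esub> y) = f x \<otimes>\<^bsub>Y\<^esub> f y"
  by (auto simp: auto_def hom_def)

lemma continuous_map_auto_nat_pow:
  assumes "group Y" "topspace T = carrier Y" and f: "f \<in> auto Y" "continuous_map T T f"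
  shows "continuous_map T T (f [^]\<^bsub>AutoGroup Y\<^esub> (n::nat))"
proof (induction n)
  case 0
  show ?case
    by (rule continuous_map_eq[OF continuous_map_id]) (simp add: assms(2) one_AutoGroup)
next
  case (Suc n)
  interpret A: group "AutoGroup Y" using assms(1) by (rule group.AutoGroup)
  have fn: "f [^]\<^bsub>AutoGroup Y\<^esub> n \<in> auto Y"
    using A.nat_pow_closed f(1) by (simp add: carrier_AutoGroup)
  show ?case
    by (rule continuous_map_eq[OF continuous_map_compose[OF f(2) Suc.IH]])
      (simp add: assms(2) mult_AutoGroup[OF fn f(1)])
qed

text \<open>Negative powers are natural powers of the inverse in \<open>AutoGroup Y\<close>. That
  inverse is defined algebraically, but on the carrier it agrees with the continuous inverse
  supplied by the homeomorphism.\<close>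

lemma continuous_map_auto_int_pow:
  assumes Y: "group Y" "topspace T = carrier Y"
    and f: "f \<in> auto Y" "homeomorphic_map T T f"
  shows "continuous_map T T (f [^]\<^bsub>AutoGroup Y\<^esub> (n::int))"
proof -
  interpret A: group "AutoGroup Y" using assms(1) by (rule group.AutoGroup)
  obtain g where g: "homeomorphic_maps T T f g"
    using f(2) by (auto simp: homeomorphic_map_maps)
  define h where "h = inv\<^bsub>AutoGroup Y\<^esub> f"
  have h: "h \<in> auto Y"
    using A.inv_closed f(1) by (simp add: carrier_AutoGroup h_def)
  have "continuous_map T T h"
  proof (rule continuous_map_eq)
    show "continuous_map T T g" using g by (simp add: homeomorphic_maps_def)
    fix x assume x: "x \<in> topspace T"
    have gx: "g x \<in> carrier Y" "f (g x) = x"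
      using g x Y(2) by (auto simp: homeomorphic_maps_def continuous_map_def)
    have "h (f (g x)) = (h \<otimes>\<^bsub>AutoGroup Y\<^esub> f) (g x)" using h f(1) gx by (simp add: mult_AutoGroup)
    also have "\<dots> = g x"
      using A.l_inv f(1) gx by (simp add: h_def carrier_AutoGroup one_AutoGroup)
    finally show "g x = h x" using gx by simp
  qed
  then have "continuous_map T T (h [^]\<^bsub>AutoGroup Y\<^esub> (nat (- n)))"
    using continuous_map_auto_nat_pow[OF Y h] by blast
  moreover have "continuous_map T T (f [^]\<^bsub>AutoGroup Y\<^esub> (nat n))"
    using continuous_map_auto_nat_pow[OF Y f(1)] f(2) homeomorphic_imp_continuous_map by blast
  moreover have "h [^]\<^bsub>AutoGroup Y\<^esub> (nat (- n)) = inv\<^bsub>AutoGroup Y\<^esub> (f [^]\<^bsub>AutoGroup Y\<^esub> (nat (- n)))"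
    unfolding h_def using A.nat_pow_inv f(1) by (metis carrier_AutoGroup)
  ultimately show ?thesis
    unfolding int_pow_def2 by (cases "n < 0") simp_all
qed

section \<open>Group structure of the semidirect product\<close>

context
  fixes Y :: "('a, 'b) monoid_scheme" and \<alpha> :: "'a \<Rightarrow> 'a"
  assumes Y: "group Y" and \<alpha>: "\<alpha> \<in> auto Y"
begin

interpretation Y: group Y by (rule Y)
interpretation A: group "AutoGroup Y" using Y by (rule group.AutoGroup)

lemma auto_int_pow: "\<alpha> [^]\<^bsub>AutoGroup Y\<^esub> (n::int) \<in> auto Y"
  using A.int_pow_closed \<alpha> by (simp add: carrier_AutoGroup)

lemma auto_int_pow_0: "x \<in> carrier Y \<Longrightarrow> (\<alpha> [^]\<^bsub>AutoGroup Y\<^esub> (0::int)) x = x"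
  by (simp add: one_AutoGroup)

lemma auto_int_pow_add:
  "x \<in> carrier Y \<Longrightarrow> (\<alpha> [^]\<^bsub>AutoGroup Y\<^esub> (n + m :: int)) x
    = (\<alpha> [^]\<^bsub>AutoGroup Y\<^esub> n) ((\<alpha> [^]\<^bsub>AutoGroup Y\<^esub> m) x)"
  using A.int_pow_mult[of \<alpha> n m] \<alpha> by (simp add: carrier_AutoGroup mult_AutoGroup auto_int_pow)

lemma auto_int_pow_closed: "x \<in> carrier Y \<Longrightarrow> (\<alpha> [^]\<^bsub>AutoGroup Y\<^esub> (n::int)) x \<in> carrier Y"
  by (rule auto_closed[OF auto_int_pow])

lemma auto_int_pow_mult:
  "x \<in> carrier Y \<Longrightarrow> y \<in> carrier Y \<Longrightarrow> (\<alpha> [^]\<^bsub>AutoGroup Y\<^esub> (n::int)) (x \<otimes>\<^bsub>Y\<^esub> y)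
    = (\<alpha> [^]\<^bsub>AutoGroup Y\<^esub> n) x \<otimes>\<^bsub>Y\<^esub> (\<alpha> [^]\<^bsub>AutoGroup Y\<^esub> n) y"
  by (rule auto_mult[OF auto_int_pow])

lemma auto_int_pow_one: "(\<alpha> [^]\<^bsub>AutoGroup Y\<^esub> (n::int)) \<one>\<^bsub>Y\<^esub> = \<one>\<^bsub>Y\<^esub>"
  using auto_int_pow[of n] hom_one[OF _ Y Y] by (auto simp: auto_def)

lemma carrier_semidirect: "carrier (semidirect_int Y \<alpha>) = carrier Y \<times> UNIV"
  by (simp add: semidirect_int_def)

lemma one_semidirect: "\<one>\<^bsub>semidirect_int Y \<alpha>\<^esub> = (\<one>\<^bsub>Y\<^esub>, 0)"
  by (simp add: semidirect_int_def)

lemma mult_semidirect: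
  "(x, n) \<otimes>\<^bsub>semidirect_int Y \<alpha>\<^esub> (y, m) = (x \<otimes>\<^bsub>Y\<^esub> (\<alpha> [^]\<^bsub>AutoGroup Y\<^esub> n) y, n + m)"
  by (simp add: semidirect_int_def)

text \<open>The first component solves y \<alpha>^(-n)(x) = 1: since \<alpha>^(-n) is
  multiplicative, y is the image of the inverse of x.\<close>

lemma semidirect_l_inv:
  assumes "x \<in> carrier Y"
  shows "((\<alpha> [^]\<^bsub>AutoGroup Y\<^esub> (- n)) (inv\<^bsub>Y\<^esub> x), - n) \<otimes>\<^bsub>semidirect_int Y \<alpha>\<^esub> (x, n)
    = \<one>\<^bsub>semidirect_int Y \<alpha>\<^esub>"
  using assms by (simp add: mult_semidirect one_semidirect auto_int_pow_mult[symmetric] auto_int_pow_one)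

lemma group_semidirect: "group (semidirect_int Y \<alpha>)"
proof (rule groupI)
  fix u v w
  assume u: "u \<in> carrier (semidirect_int Y \<alpha>)" and v: "v \<in> carrier (semidirect_int Y \<alpha>)"
  then show "u \<otimes>\<^bsub>semidirect_int Y \<alpha>\<^esub> v \<in> carrier (semidirect_int Y \<alpha>)"
    by (auto simp: carrier_semidirect mult_semidirect auto_int_pow_closed)
  assume w: "w \<in> carrier (semidirect_int Y \<alpha>)"
  obtain x n y m z k where eq: "u = (x, n)" "v = (y, m)" "w = (z, k)"
    by (cases u; cases v; cases w) blast
  have "x \<in> carrier Y" "y \<in> carrier Y" "z \<in> carrier Y"
    using u v w by (auto simp: eq carrier_semidirect)
  then show "u \<otimes>\<^bsub>semidirect_int Y \<alpha>\<^esub> v \<otimes>\<^bsub>semidirect_int Y \<alpha>\<^esub> w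
      = u \<otimes>\<^bsub>semidirect_int Y \<alpha>\<^esub> (v \<otimes>\<^bsub>semidirect_int Y \<alpha>\<^esub> w)"
    by (simp add: eq mult_semidirect auto_int_pow_add auto_int_pow_mult auto_int_pow_closed Y.m_assoc)
next
  show "\<one>\<^bsub>semidirect_int Y \<alpha>\<^esub> \<in> carrier (semidirect_int Y \<alpha>)"
    by (simp add: carrier_semidirect one_semidirect)
next
  fix u assume u: "u \<in> carrier (semidirect_int Y \<alpha>)"
  then show "\<one>\<^bsub>semidirect_int Y \<alpha>\<^esub> \<otimes>\<^bsub>semidirect_int Y \<alpha>\<^esub> u = u"
    by (auto simp: carrier_semidirect one_semidirect mult_semidirect one_AutoGroup)
  obtain x n where eq: "u = (x, n)" by (cases u)
  with u have x: "x \<in> carrier Y" by (simp add: carrier_semidirect)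
  show "\<exists>v\<in>carrier (semidirect_int Y \<alpha>). v \<otimes>\<^bsub>semidirect_int Y \<alpha>\<^esub> u = \<one>\<^bsub>semidirect_int Y \<alpha>\<^esub>"
    unfolding eq using semidirect_l_inv[OF x, of n] auto_int_pow_closed[of "inv\<^bsub>Y\<^esub> x" "- n"] x
    by (intro bexI[where x = "((\<alpha> [^]\<^bsub>AutoGroup Y\<^esub> (- n)) (inv\<^bsub>Y\<^esub> x), - n)"])
      (simp_all add: carrier_semidirect)
qed

lemma inv_semidirect:
  assumes "x \<in> carrier Y"
  shows "inv\<^bsub>semidirect_int Y \<alpha>\<^esub> (x, n) = ((\<alpha> [^]\<^bsub>AutoGroup Y\<^esub> (- n)) (inv\<^bsub>Y\<^esub> x), - n)"
  using assms by (intro group.inv_equality[OF group_semidirect] semidirect_l_inv)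
    (auto simp: carrier_semidirect auto_int_pow_closed)

end

text \<open>Both operations are composed from those of Y, those of the integers and the map (x, n)
  \<mapsto> \<alpha>^n(x), which is jointly continuous because the integers are discrete.\<close>

lemma topological_group_semidirect:
  assumes TG: "topological_group Y T" and \<alpha>: "\<alpha> \<in> auto Y" and homeo: "homeomorphic_map T T \<alpha>"
  shows "topological_group (semidirect_int Y \<alpha>) (semidirect_int_topology T)"
proof -
  define D where "D = discrete_topology (UNIV :: int set)"
  have Y: "group Y" and ts: "topspace T = carrier Y"
    and mult: "continuous_map (prod_topology T T) T (\<lambda>(x, y). x \<otimes>\<^bsub>Y\<^esub> y)"
    and inv: "continuous_map T T (\<lambda>x. inv\<^bsub>Y\<^esub> x)"
    using TG by (auto simp: topological_group_def)
  let ?G = "semidirect_int Y \<alpha>" and ?A = "\<lambda>n::int. \<alpha> [^]\<^bsub>AutoGroup Y\<^esub> n"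
  have top: "semidirect_int_topology T = prod_topology T D"
    by (simp add: semidirect_int_topology_def D_def)
  have cA: "continuous_map (prod_topology T D) T (\<lambda>(x, n). ?A n x)"
    unfolding D_def using continuous_map_auto_int_pow[OF Y ts \<alpha> homeo]
    by (rule continuous_map_discrete_family)
  let ?P = "prod_topology (prod_topology T D) (prod_topology T D)"
  have f1: "continuous_map ?P T (\<lambda>w. fst (fst w))" and f2: "continuous_map ?P D (\<lambda>w. snd (fst w))"
    and f3: "continuous_map ?P T (\<lambda>w. fst (snd w))" and f4: "continuous_map ?P D (\<lambda>w. snd (snd w))"
    using continuous_map_compose[OF continuous_map_fst continuous_map_fst]
      continuous_map_compose[OF continuous_map_fst continuous_map_snd]
      continuous_map_compose[OF continuous_map_snd continuous_map_fst]
      continuous_map_compose[OF continuous_map_snd continuous_map_snd]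
    by (auto simp: o_def)
  have "continuous_map ?P T (\<lambda>w. ?A (snd (fst w)) (fst (snd w)))"
    using continuous_map_compose[OF continuous_map_pairedI[OF f3 f2] cA] by (simp add: o_def)
  from continuous_map_compose[OF continuous_map_pairedI[OF f1 this] mult]
  have c1: "continuous_map ?P T (\<lambda>w. fst (fst w) \<otimes>\<^bsub>Y\<^esub> ?A (snd (fst w)) (fst (snd w)))"
    by (simp add: o_def)
  have "continuous_map (prod_topology D D) D (\<lambda>(n, m). n + m)"
    by (simp add: D_def continuous_map_def flip: prod_topology_discrete_topology)
  from continuous_map_compose[OF continuous_map_pairedI[OF f2 f4] this]
  have c2: "continuous_map ?P D (\<lambda>w. snd (fst w) + snd (snd w))" by (simp add: o_def)
  have "(\<lambda>(u, v). u \<otimes>\<^bsub>?G\<^esub> v)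
      = (\<lambda>w. (fst (fst w) \<otimes>\<^bsub>Y\<^esub> ?A (snd (fst w)) (fst (snd w)), snd (fst w) + snd (snd w)))"
    by (auto simp: semidirect_int_def)
  then have "continuous_map ?P (prod_topology T D) (\<lambda>(u, v). u \<otimes>\<^bsub>?G\<^esub> v)"
    using continuous_map_pairedI[OF c1 c2] by simp
  moreover have "continuous_map (prod_topology T D) (prod_topology T D) (\<lambda>u. inv\<^bsub>?G\<^esub> u)"
  proof (rule continuous_map_eq)
    have g1: "continuous_map (prod_topology T D) T (\<lambda>u. inv\<^bsub>Y\<^esub> fst u)"
      using continuous_map_compose[OF continuous_map_fst inv] by (simp add: o_def)
    have "continuous_map D D uminus" by (simp add: D_def continuous_map_def)
    from continuous_map_compose[OF continuous_map_snd this]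
    have g2: "continuous_map (prod_topology T D) D (\<lambda>u. - snd u)" by (simp add: o_def)
    show "continuous_map (prod_topology T D) (prod_topology T D)
        (\<lambda>u. (?A (- snd u) (inv\<^bsub>Y\<^esub> fst u), - snd u))"
      using continuous_map_pairedI[OF continuous_map_compose[OF continuous_map_pairedI[OF g1 g2] cA] g2]
      by (simp add: o_def)
    fix u assume "u \<in> topspace (prod_topology T D)"
    then have "fst u \<in> carrier Y" by (simp only: topspace_prod_topology ts mem_Times_iff)
    from inv_semidirect[OF Y \<alpha> this, of "snd u"]
    show "(?A (- snd u) (inv\<^bsub>Y\<^esub> fst u), - snd u) = inv\<^bsub>?G\<^esub> u" by simp
  qed
  ultimately show ?thesis
    unfolding topological_group_def top
    by (simp add: group_semidirect[OF Y \<alpha>] carrier_semidirect[OF Y \<alpha>] ts D_def)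
qed

section \<open>Duoseparability and copies of groups in a semidirect product\<close>

text \<open>The hypothesis \<open>attract\<close> carries the topology of the argument. Only the
  slice of U over the integer 0 is used: the left factor from S undoes \<alpha>^m, and the right one
  restores the integer coordinate.\<close>

lemma duoseparable_semidirect:
  assumes TG: "topological_group Y T" and \<alpha>: "\<alpha> \<in> auto Y"
    and attract: "\<And>x W. x \<in> carrier Y \<Longrightarrow> openin T W \<Longrightarrow> \<one>\<^bsub>Y\<^esub> \<in> W \<Longrightarrow>
      \<exists>m::int. (\<alpha> [^]\<^bsub>AutoGroup Y\<^esub> m) x \<in> W"
  shows "duoseparable (semidirect_int Y \<alpha>) (semidirect_int_topology T)"
  unfolding duoseparable_def
proof (intro exI conjI allI impI)
  let ?G = "semidirect_int Y \<alpha>" and ?S = "{\<one>\<^bsub>Y\<^esub>} \<times> (UNIV :: int set)"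
  have Y: "group Y" and ts: "topspace T = carrier Y" using TG by (auto simp: topological_group_def)
  interpret Y: group Y by (rule Y)
  interpret G: group ?G by (rule group_semidirect[OF Y \<alpha>])
  show S: "?S \<subseteq> carrier ?G" by (auto simp: carrier_semidirect[OF Y \<alpha>])
  show "countable ?S" by simp
  fix U assume UG: "U \<subseteq> carrier ?G"
    and "\<exists>V\<subseteq>U. openin (semidirect_int_topology T) V \<and> \<one>\<^bsub>?G\<^esub> \<in> V"
  then obtain V where V: "V \<subseteq> U" "openin (semidirect_int_topology T) V" "\<one>\<^bsub>?G\<^esub> \<in> V" by blast
  define W where "W = {x \<in> topspace T. (x, 0) \<in> V}"
  have "continuous_map T (semidirect_int_topology T) (\<lambda>x. (x, 0))"
    unfolding semidirect_int_topology_def by (intro continuous_map_pairedI) simp_all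
  then have W: "openin T W" unfolding W_def by (rule openin_continuous_map_preimage[OF _ V(2)])
  have W1: "\<one>\<^bsub>Y\<^esub> \<in> W" using V(3) by (simp add: W_def ts one_semidirect[OF Y \<alpha>])
  show "carrier ?G = (?S <#>\<^bsub>?G\<^esub> U) <#>\<^bsub>?G\<^esub> ?S"
  proof
    show "(?S <#>\<^bsub>?G\<^esub> U) <#>\<^bsub>?G\<^esub> ?S \<subseteq> carrier ?G"
      by (intro G.set_mult_closed S UG)
    show "carrier ?G \<subseteq> (?S <#>\<^bsub>?G\<^esub> U) <#>\<^bsub>?G\<^esub> ?S"
    proof
      fix w assume "w \<in> carrier ?G"
      then obtain x k where w: "w = (x, k)" and x: "x \<in> carrier Y"
        by (cases w) (auto simp: carrier_semidirect[OF Y \<alpha>])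
      obtain m :: int where m: "(\<alpha> [^]\<^bsub>AutoGroup Y\<^esub> m) x \<in> W" using attract[OF x W W1] by blast
      define u where "u = ((\<alpha> [^]\<^bsub>AutoGroup Y\<^esub> m) x, 0 :: int)"
      have u: "u \<in> U" using m V(1) by (auto simp: W_def u_def)
      have "(\<alpha> [^]\<^bsub>AutoGroup Y\<^esub> (- m)) ((\<alpha> [^]\<^bsub>AutoGroup Y\<^esub> m) x) = x"
        using auto_int_pow_add[OF Y \<alpha> x, of "- m" m] auto_int_pow_0[OF Y \<alpha> x] by simp
      then have "w = ((\<one>\<^bsub>Y\<^esub>, - m) \<otimes>\<^bsub>?G\<^esub> u) \<otimes>\<^bsub>?G\<^esub> (\<one>\<^bsub>Y\<^esub>, m + k)"
        using x by (simp add: w u_def mult_semidirect[OF Y \<alpha>] auto_int_pow_one[OF Y \<alpha>])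
      moreover have "(\<one>\<^bsub>Y\<^esub>, - m) \<in> ?S" "(\<one>\<^bsub>Y\<^esub>, m + k) \<in> ?S" by simp_all
      ultimately show "w \<in> (?S <#>\<^bsub>?G\<^esub> U) <#>\<^bsub>?G\<^esub> ?S"
        using u unfolding set_mult_def by blast
    qed
  qed
qed

lemma contains_topological_copyI:
  assumes X: "group X" "topspace T\<^sub>X = carrier X" and G: "group G"
    and j: "j \<in> hom X G" "inj_on j (carrier X)"
    and top: "embedding_map T\<^sub>X T j"
  shows "contains_topological_copy G T X T\<^sub>X"
  unfolding contains_topological_copy_def
proof (intro exI conjI)
  interpret group_hom X G j
    by (intro group_hom.intro group_hom_axioms.intro X G j)
  show "subgroup (j ` carrier X) G" by (rule img_is_subgroup)
  show "j \<in> iso X (G\<lparr>carrier := j ` carrier X\<rparr>)"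
    using j by (auto simp: iso_def hom_def bij_betw_def)
  show "homeomorphic_map T\<^sub>X (subtopology T (j ` carrier X)) j"
    using top by (simp add: embedding_map_def X(2))
qed

text \<open>The slice over 0 is a copy of Y, because \<alpha>^0 acts trivially and
  \<open>fst\<close> inverts the inclusion continuously; a copy of X inside Y is carried
  along.\<close>

lemma contains_topological_copy_semidirect:
  assumes TG: "topological_group Y T" and \<alpha>: "\<alpha> \<in> auto Y"
    and X: "group X" "topspace T\<^sub>X = carrier X"
    and j: "j \<in> hom X Y" "inj_on j (carrier X)" and top: "embedding_map T\<^sub>X T j"
  shows "contains_topological_copy (semidirect_int Y \<alpha>) (semidirect_int_topology T) X T\<^sub>X"
proof (rule contains_topological_copyI[OF X])
  have Y: "group Y" and ts: "topspace T = carrier Y" using TG by (auto simp: topological_group_def)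
  show "group (semidirect_int Y \<alpha>)" by (rule group_semidirect[OF Y \<alpha>])
  have jY: "j x \<in> carrier Y" if "x \<in> carrier X" for x using j(1) that by (auto simp: hom_def)
  show "(\<lambda>x. (x, 0)) \<circ> j \<in> hom X (semidirect_int Y \<alpha>)"
    using j(1) by (auto simp: hom_def carrier_semidirect[OF Y \<alpha>] mult_semidirect[OF Y \<alpha>]
        one_AutoGroup jY)
  show "inj_on ((\<lambda>x. (x, 0)) \<circ> j) (carrier X)"
    using j(2) by (auto simp: inj_on_def)
  have "embedding_map T (semidirect_int_topology T) (\<lambda>x. (x, 0))"
    unfolding semidirect_int_topology_def embedding_map_def homeomorphic_map_maps
  proof (intro exI)
    show "homeomorphic_maps T (subtopology (prod_topology T (discrete_topology UNIV))
        ((\<lambda>x. (x, 0)) ` topspace T)) (\<lambda>x. (x, 0)) fst"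
      unfolding homeomorphic_maps_def
      by (auto simp: continuous_map_in_subtopology
          intro!: continuous_map_from_subtopology continuous_map_fst continuous_map_pairedI)
  qed
  then show "embedding_map T\<^sub>X (semidirect_int_topology T) ((\<lambda>x. (x, 0)) \<circ> j)"
    by (rule embedding_map_compose[OF top])
qed

section \<open>The automorphism of \<open>HM0 X\<close>\<close>

text \<open>The inverse is part of the data and the notion is symmetric in \<phi> and \<psi>, so
  squaring and the square root share all lemmas except the measure estimates. Fixing 0 preserves the
  condition f 0 = 1.\<close>

definition unit_reparam :: "(real \<Rightarrow> real) \<Rightarrow> (real \<Rightarrow> real) \<Rightarrow> bool" where
  "unit_reparam \<phi> \<psi> \<longleftrightarrow> \<phi> 0 = 0 \<and>
     (\<forall>t\<in>{0..<1}. \<phi> t \<in> {0..<1} \<and> \<psi> (\<phi> t) = t) \<and>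
     (\<forall>t\<in>{0..<1}. \<psi> t \<in> {0..<1} \<and> \<phi> (\<psi> t) = t) \<and>
     (\<forall>s\<in>{0..<1}. \<forall>t\<in>{0..<1}. s \<le> t \<longrightarrow> \<phi> s \<le> \<phi> t \<and> \<psi> s \<le> \<psi> t)"

lemma unit_reparam_sym:
  assumes "unit_reparam \<phi> \<psi>"
  shows "unit_reparam \<psi> \<phi>"
proof -
  have "\<phi> 0 = 0" "\<forall>t\<in>{0..<1}. \<psi> (\<phi> t) = t" using assms unfolding unit_reparam_def by blast+
  then have "\<psi> 0 = 0" using atLeastLessThan_iff[of "0::real" 0 1] by force
  then show ?thesis using assms unfolding unit_reparam_def by blast
qed

lemma unit_reparamD:
  assumes "unit_reparam \<phi> \<psi>" "t \<in> {0..<1}"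
  shows "\<phi> t \<in> {0..<1}" "\<psi> t \<in> {0..<1}" "\<psi> (\<phi> t) = t" "\<phi> (\<psi> t) = t"
  using assms unfolding unit_reparam_def by blast+

lemma step_unit_reparam:
  assumes r: "unit_reparam \<phi> \<psi>" and "step F"
  shows "step (\<lambda>t. F (\<phi> t))"
proof (rule step_reparam[OF \<open>step F\<close>])
  show "inj_on \<phi> {0..<1}" by (rule inj_on_inverseI[where g = \<psi>]) (rule unit_reparamD(3)[OF r])
  show "{0..<1} \<subseteq> \<phi> ` {0..<1}"
  proof
    fix t :: real assume "t \<in> {0..<1}"
    from unit_reparamD(2,4)[OF r this] show "t \<in> \<phi> ` {0..<1}" by (metis image_eqI)
  qed
  fix s t :: real assume "0 \<le> s" "s \<le> t" "t < 1"
  then show "\<phi> s \<le> \<phi> t" using r unfolding unit_reparam_def by simp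
qed (rule unit_reparamD(1)[OF r])

definition reparam :: "(real \<Rightarrow> real) \<Rightarrow> (real \<Rightarrow> 'a) \<Rightarrow> (real \<Rightarrow> 'a)" where
  "reparam \<phi> f = (\<lambda>t\<in>{0..<1}. f (\<phi> t))"

lemma reparam_closed:
  assumes r: "unit_reparam \<phi> \<psi>" and f: "f \<in> carrier (HM0 X)"
  shows "reparam \<phi> f \<in> carrier (HM0 X)"
proof -
  have "reparam \<phi> f \<in> carrier (HM X)"
    unfolding reparam_def
    by (rule HM_carrierI[OF step_unit_reparam[OF r HM0_step[OF f]]])
      (rule HM0_in[OF f unit_reparamD(1)[OF r]])
  moreover have "reparam \<phi> f 0 = f 0" using r by (simp add: reparam_def unit_reparam_def)
  ultimately show ?thesis using f by (simp add: HM0_carrier_iff)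
qed

lemma reparam_reparam:
  assumes r: "unit_reparam \<phi> \<psi>" and f: "f \<in> carrier (HM0 X)"
  shows "reparam \<phi> (reparam \<psi> f) = f"
proof (rule HM_ext[symmetric])
  show "f \<in> carrier (HM X)" using f by (simp add: HM0_carrier_iff)
  show "reparam \<phi> (reparam \<psi> f) \<in> extensional {0..<1}" by (simp add: reparam_def)
  fix t :: real assume "t \<in> {0..<1}"
  from unit_reparamD[OF r this] this show "f t = reparam \<phi> (reparam \<psi> f) t"
    by (simp add: reparam_def)
qed

text \<open>\<phi> maps the exceptional set E of g \<circ> \<phi> relative to V onto that of g
  relative to V \<circ> \<psi>, which leaves exactly \<open>small\<close>. Measurability of E and of
  its image may be assumed there, since both are exceptional sets of step functions.\<close>

lemma continuous_map_reparam:
  assumes X: "topspace T = carrier X" and r: "unit_reparam \<phi> \<psi>"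
    and small: "\<And>\<delta>. 0 < \<delta> \<Longrightarrow> \<exists>\<delta>'>0. \<forall>E. E \<subseteq> {0..<1} \<longrightarrow> E \<in> lmeasurable \<longrightarrow>
      \<phi> ` E \<in> lmeasurable \<longrightarrow> measure lebesgue (\<phi> ` E) < \<delta>' \<longrightarrow> measure lebesgue E < \<delta>"
  shows "continuous_map (HM0_topology X T) (HM0_topology X T) (reparam \<phi>)"
proof (rule continuous_map_HM0I[OF X X reparam_closed[OF r]])
  fix f V and \<delta> :: real
  assume f: "f \<in> carrier (HM0 X)" and V: "open_step_cover T (reparam \<phi> f) V" and "0 < \<delta>"
  have Vs: "step V" using V by (simp add: open_step_cover_def)
  have V's: "step (\<lambda>u. V (\<psi> u))" by (rule step_unit_reparam[OF unit_reparam_sym[OF r] Vs])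
  have "open_step_cover T f (\<lambda>u. V (\<psi> u))"
    unfolding open_step_cover_def
  proof (intro conjI ballI V's)
    fix u :: real assume u: "u \<in> {0..<1}"
    note ru = unit_reparamD[OF r u]
    show "openin T (V (\<psi> u))" using V ru(2) unfolding open_step_cover_def by blast
    have "reparam \<phi> f (\<psi> u) \<in> V (\<psi> u)" using V ru(2) unfolding open_step_cover_def by blast
    then show "f u \<in> V (\<psi> u)" using ru(2,4) by (simp add: reparam_def)
  qed
  moreover obtain \<delta>' where "0 < \<delta>'" and \<delta>': "\<And>E. E \<subseteq> {0..<1} \<Longrightarrow> E \<in> lmeasurable \<Longrightarrow>
      \<phi> ` E \<in> lmeasurable \<Longrightarrow> measure lebesgue (\<phi> ` E) < \<delta>' \<Longrightarrow> measure lebesgue E < \<delta>"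
    using small[OF \<open>0 < \<delta>\<close>] by blast
  moreover have "reparam \<phi> g \<in> HM_nbhd X V \<delta>"
    if "g \<in> HM_nbhd X (\<lambda>u. V (\<psi> u)) \<delta>' \<inter> carrier (HM0 X)" for g
  proof -
    have g: "g \<in> HM_nbhd X (\<lambda>u. V (\<psi> u)) \<delta>'" "g \<in> carrier (HM0 X)" using that by auto
    note rg = reparam_closed[OF r g(2)]
    define E where "E = {t \<in> {0..<1}. reparam \<phi> g t \<notin> V t}"
    have img: "\<phi> ` E = {u \<in> {0..<1}. g u \<notin> V (\<psi> u)}"
    proof (intro subset_antisym subsetI)
      fix u assume "u \<in> \<phi> ` E"
      then obtain t where t: "t \<in> {0..<1}" "reparam \<phi> g t \<notin> V t" "u = \<phi> t" unfolding E_def by blast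
      from unit_reparamD[OF r t(1)] t show "u \<in> {u \<in> {0..<1}. g u \<notin> V (\<psi> u)}"
        by (simp add: reparam_def)
    next
      fix u assume "u \<in> {u \<in> {0..<1}. g u \<notin> V (\<psi> u)}"
      then have u: "u \<in> {0..<1}" "g u \<notin> V (\<psi> u)" by auto
      note ru = unit_reparamD[OF r u(1)]
      have "\<psi> u \<in> E" using ru u unfolding E_def by (simp add: reparam_def)
      then show "u \<in> \<phi> ` E" using ru(4) by (metis image_eqI)
    qed
    have "measure lebesgue E < \<delta>"
    proof (rule \<delta>')
      show "E \<subseteq> {0..<1}" unfolding E_def by blast
      show "E \<in> lmeasurable" unfolding E_def by (rule bad_set_lmeasurable[OF HM0_step[OF rg] Vs])
      show "\<phi> ` E \<in> lmeasurable" unfolding img by (rule bad_set_lmeasurable[OF HM0_step[OF g(2)] V's])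
      show "measure lebesgue (\<phi> ` E) < \<delta>'" using g(1) unfolding img by (simp add: HM_nbhd_def)
    qed
    then show ?thesis using rg unfolding E_def by (simp add: HM_nbhd_def HM0_carrier_iff)
  qed
  ultimately show "\<exists>V' \<delta>'. open_step_cover T f V' \<and> 0 < \<delta>' \<and>
      (\<forall>g\<in>HM_nbhd X V' \<delta>' \<inter> carrier (HM0 X). reparam \<phi> g \<in> HM_nbhd X V \<delta>)"
    by blast
qed

text \<open>Both bounds come from \<open>\<lambda>(s E) = \<integral>\<^sub>E 2t dt\<close> for \<open>s t = t\<^sup>2\<close>. In the second one the part of
  \<open>E\<close> below \<open>\<eta>\<close> is discarded, because \<open>s\<close> shrinks sets near \<open>0\<close> by an unbounded factor.\<close>

lemma measure_square_image:
  fixes E :: "real set"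
  assumes E: "E \<subseteq> {0..<1}" "E \<in> lmeasurable" "(\<lambda>t. t\<^sup>2) ` E \<in> lmeasurable"
  shows "(\<lambda>t. \<bar>2 * t\<bar>) absolutely_integrable_on E"
    and "measure lebesgue ((\<lambda>t. t\<^sup>2) ` E) = integral E (\<lambda>t. \<bar>2 * t\<bar>)"
proof -
  \<comment> \<open>This is the change of variables for the integrand 1: its right side follows from
    measurability of the image, and its left side is then the claim.\<close>
  have "(\<lambda>t. \<bar>2 * t\<bar> * 1) absolutely_integrable_on E \<and>
      integral E (\<lambda>t. \<bar>2 * t\<bar> * 1) = measure lebesgue ((\<lambda>t. t\<^sup>2) ` E) \<longleftrightarrow>
    (\<lambda>_. 1 :: real) absolutely_integrable_on (\<lambda>t. t\<^sup>2) ` E \<and>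
      integral ((\<lambda>t. t\<^sup>2) ` E) (\<lambda>_. 1 :: real) = measure lebesgue ((\<lambda>t. t\<^sup>2) ` E)"
  proof (rule has_absolute_integral_change_of_variables_1')
    show "E \<in> sets lebesgue" using E(2) by (rule fmeasurableD)
    show "inj_on (\<lambda>t. t\<^sup>2) E" using E(1) by (intro inj_onI) (auto simp: power2_eq_iff_nonneg subset_iff)
    show "((\<lambda>t. t\<^sup>2) has_field_derivative 2 * t) (at t within E)" for t
      by (auto intro!: derivative_eq_intros)
  qed
  moreover have "(\<lambda>_. 1 :: real) absolutely_integrable_on (\<lambda>t. t\<^sup>2) ` E"
    using E(3) by (rule absolutely_integrable_on_const)
  moreover have "integral ((\<lambda>t. t\<^sup>2) ` E) (\<lambda>_. 1 :: real) = measure lebesgue ((\<lambda>t. t\<^sup>2) ` E)"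
    by (rule lmeasure_integral[OF E(3), symmetric])
  ultimately show "(\<lambda>t. \<bar>2 * t\<bar>) absolutely_integrable_on E"
    and "measure lebesgue ((\<lambda>t. t\<^sup>2) ` E) = integral E (\<lambda>t. \<bar>2 * t\<bar>)" by simp_all
qed

lemma integral_const_lmeasurable:
  fixes c :: real
  assumes "E \<in> lmeasurable"
  shows "(\<lambda>_. c) integrable_on E" "integral E (\<lambda>_. c) = c * measure lebesgue E"
proof -
  show "(\<lambda>_. c) integrable_on E" by (rule integrable_on_const[OF assms])
  have "integral E (\<lambda>_. c * 1) = c * integral E (\<lambda>_. 1)" by (rule integral_mult_right)
  then show "integral E (\<lambda>_. c) = c * measure lebesgue E" by (simp add: lmeasure_integral[OF assms])
qed

lemma measure_square_image_le:
  fixes E :: "real set"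
  assumes E: "E \<subseteq> {0..<1}" "E \<in> lmeasurable" "(\<lambda>t. t\<^sup>2) ` E \<in> lmeasurable"
  shows "measure lebesgue ((\<lambda>t. t\<^sup>2) ` E) \<le> 2 * measure lebesgue E"
proof -
  have "integral E (\<lambda>t. \<bar>2 * t\<bar>) \<le> integral E (\<lambda>_. 2 :: real)"
  proof (rule integral_le)
    show "(\<lambda>t. \<bar>2 * t\<bar>) integrable_on E"
      by (rule set_lebesgue_integral_eq_integral(1)[OF measure_square_image(1)[OF E]])
    show "(\<lambda>_. 2 :: real) integrable_on E" by (rule integral_const_lmeasurable(1)[OF E(2)])
    show "\<bar>2 * t\<bar> \<le> 2" if "t \<in> E" for t
    proof -
      have "t \<in> {0..<1}" using E(1) that by blast
      then show ?thesis by simp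
    qed
  qed
  then show ?thesis
    by (simp only: measure_square_image(2)[OF E] integral_const_lmeasurable(2)[OF E(2)])
qed

lemma measure_le_square_image:
  fixes E :: "real set"
  assumes E: "E \<subseteq> {0..<1}" "E \<in> lmeasurable" "(\<lambda>t. t\<^sup>2) ` E \<in> lmeasurable" and "0 < \<eta>"
  shows "measure lebesgue E \<le> \<eta> + measure lebesgue ((\<lambda>t. t\<^sup>2) ` E) / (2 * \<eta>)"
proof -
  define E' where "E' = E \<inter> {\<eta>..}"
  have E': "E' \<in> lmeasurable" unfolding E'_def using E(2) by (intro fmeasurable_Int_fmeasurable) auto
  have sub: "E \<subseteq> {0..\<eta>} \<union> E'" using E(1) unfolding E'_def by fastforce
  have "measure lebesgue E \<le> measure lebesgue ({0..\<eta>} \<union> E')"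
    using E(2) E' sub by (intro measure_mono_fmeasurable fmeasurableD fmeasurable.Un) auto
  also have "\<dots> \<le> measure lebesgue {0..\<eta>} + measure lebesgue E'"
    using E' by (intro measure_Un_le fmeasurableD) auto
  finally have 1: "measure lebesgue E \<le> \<eta> + measure lebesgue E'" using \<open>0 < \<eta>\<close> by simp
  have int: "(\<lambda>t. \<bar>2 * t\<bar>) integrable_on E" "(\<lambda>t. \<bar>2 * t\<bar>) integrable_on E'"
    using measure_square_image(1)[OF E] set_integrable_subset[OF measure_square_image(1)[OF E] fmeasurableD[OF E']]
    by (auto intro: set_lebesgue_integral_eq_integral(1) simp: E'_def)
  \<comment> \<open>On E' the derivative 2t is at least 2 \<eta>.\<close>
  have "2 * \<eta> * measure lebesgue E' = integral E' (\<lambda>_. 2 * \<eta>)"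
    by (simp only: integral_const_lmeasurable(2)[OF E'])
  also have "\<dots> \<le> integral E' (\<lambda>t. \<bar>2 * t\<bar>)"
    using int(2) \<open>0 < \<eta>\<close> by (intro integral_le integral_const_lmeasurable(1)[OF E']) (auto simp: E'_def)
  also have "\<dots> \<le> integral E (\<lambda>t. \<bar>2 * t\<bar>)"
    using int by (intro integral_subset_le) (auto simp: E'_def)
  also have "\<dots> = measure lebesgue ((\<lambda>t. t\<^sup>2) ` E)" by (rule measure_square_image(2)[OF E, symmetric])
  finally have "measure lebesgue E' \<le> measure lebesgue ((\<lambda>t. t\<^sup>2) ` E) / (2 * \<eta>)"
    using \<open>0 < \<eta>\<close> by (simp add: field_simps)
  with 1 show ?thesis by simp
qed

lemma unit_reparam_square: "unit_reparam (\<lambda>t. t\<^sup>2) sqrt"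
  unfolding unit_reparam_def
  by (auto simp: power_strict_decreasing abs_square_less_1 real_sqrt_lt_1_iff intro: power_mono)

section \<open>Squaring as an automorphism of \<open>HM0 X\<close>, and its iterates\<close>

context
  fixes X :: "('a, 'b) monoid_scheme" and T :: "'a topology"
  assumes TG: "topological_group X T"
begin

lemma continuous_map_reparam_square:
  "continuous_map (HM0_topology X T) (HM0_topology X T) (reparam (\<lambda>t. t\<^sup>2))"
proof (rule continuous_map_reparam[OF X_top[OF TG] unit_reparam_square])
  fix \<delta> :: real assume \<delta>: "0 < \<delta>"
  show "\<exists>\<delta>'>0. \<forall>E :: real set. E \<subseteq> {0..<1} \<longrightarrow> E \<in> lmeasurable \<longrightarrow> (\<lambda>t. t\<^sup>2) ` E \<in> lmeasurable \<longrightarrow>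
      measure lebesgue ((\<lambda>t. t\<^sup>2) ` E) < \<delta>' \<longrightarrow> measure lebesgue E < \<delta>"
  \<comment> \<open>With \<eta> = \<delta>/2 the discarded part costs \<delta>/2; the other term is
    the measure of the image divided by \<delta>, which stays below \<delta>/2 if the image has
    measure below \<delta>^2/2.\<close>
  proof (intro exI[of _ "\<delta>\<^sup>2 / 2"] conjI allI impI)
    fix E :: "real set" assume E: "E \<subseteq> {0..<1}" "E \<in> lmeasurable" "(\<lambda>t. t\<^sup>2) ` E \<in> lmeasurable"
      and m: "measure lebesgue ((\<lambda>t. t\<^sup>2) ` E) < \<delta>\<^sup>2 / 2"
    have "measure lebesgue E \<le> \<delta> / 2 + measure lebesgue ((\<lambda>t. t\<^sup>2) ` E) / (2 * (\<delta> / 2))"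
      using \<delta> by (intro measure_le_square_image[OF E]) simp
    also have "\<dots> < \<delta> / 2 + (\<delta>\<^sup>2 / 2) / (2 * (\<delta> / 2))"
      using m \<delta> by (intro add_strict_left_mono divide_strict_right_mono) auto
    also have "\<dots> = \<delta>" using \<delta> by (simp add: field_simps power2_eq_square)
    finally show "measure lebesgue E < \<delta>" .
  qed (use \<delta> in simp)
qed

lemma continuous_map_reparam_sqrt:
  "continuous_map (HM0_topology X T) (HM0_topology X T) (reparam sqrt)"
proof (rule continuous_map_reparam[OF X_top[OF TG] unit_reparam_sym[OF unit_reparam_square]])
  fix \<delta> :: real assume \<delta>: "0 < \<delta>"
  show "\<exists>\<delta>'>0. \<forall>E. E \<subseteq> {0..<1} \<longrightarrow> E \<in> lmeasurable \<longrightarrow> sqrt ` E \<in> lmeasurable \<longrightarrow>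
      measure lebesgue (sqrt ` E) < \<delta>' \<longrightarrow> measure lebesgue E < \<delta>"
  \<comment> \<open>Squaring at most doubles measure, and E is the image under squaring of its set
    of roots.\<close>
  proof (intro exI[of _ "\<delta> / 2"] conjI allI impI)
    fix E :: "real set" assume E: "E \<subseteq> {0..<1}" "E \<in> lmeasurable" "sqrt ` E \<in> lmeasurable"
      and m: "measure lebesgue (sqrt ` E) < \<delta> / 2"
    have sq: "(\<lambda>t. t\<^sup>2) ` sqrt ` E = E"
    proof -
      have "(sqrt t)\<^sup>2 = t" if "t \<in> E" for t
        using E(1) that by (intro real_sqrt_pow2) auto
      then show ?thesis by (simp add: image_image)
    qed
    have sub: "sqrt ` E \<subseteq> {0..<1}" using E(1) by auto
    have "measure lebesgue E \<le> 2 * measure lebesgue (sqrt ` E)"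
      using measure_square_image_le[OF sub E(3)] E(2) unfolding sq by simp
    with m show "measure lebesgue E < \<delta>" by simp
  qed (use \<delta> in simp)
qed

lemma HM0_aut_eq: "f \<in> carrier (HM0 X) \<Longrightarrow> HM0_aut X f = reparam (\<lambda>t. t\<^sup>2) f"
  by (simp add: HM0_aut_def reparam_def)

lemma homeomorphic_map_HM0_aut:
  "homeomorphic_map (HM0_topology X T) (HM0_topology X T) (HM0_aut X)"
proof -
  have "homeomorphic_maps (HM0_topology X T) (HM0_topology X T) (HM0_aut X) (reparam sqrt)"
    unfolding homeomorphic_maps_def topspace_HM0[OF X_top[OF TG]]
  proof (intro conjI ballI continuous_map_reparam_sqrt)
    show "continuous_map (HM0_topology X T) (HM0_topology X T) (HM0_aut X)"
      by (rule continuous_map_eq[OF continuous_map_reparam_square])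
        (simp add: topspace_HM0[OF X_top[OF TG]] HM0_aut_eq)
    fix f assume f: "f \<in> carrier (HM0 X)"
    show "reparam sqrt (HM0_aut X f) = f"
      by (simp only: HM0_aut_eq[OF f] reparam_reparam[OF unit_reparam_sym[OF unit_reparam_square] f])
    show "HM0_aut X (reparam sqrt f) = f"
      by (simp only: HM0_aut_eq[OF reparam_closed[OF unit_reparam_sym[OF unit_reparam_square] f]]
          reparam_reparam[OF unit_reparam_square f])
  qed
  then show ?thesis by (auto simp: homeomorphic_map_maps)
qed

text \<open>Bijectivity is inherited from the homeomorphism and multiplicativity from the pointwise
  product; the outer restriction in \<open>HM0_aut\<close> supplies the extensionality that
  \<open>Bij\<close> demands.\<close>

lemma HM0_aut_in_auto: "HM0_aut X \<in> auto (HM0 X)"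
proof -
  have bij: "bij_betw (HM0_aut X) (carrier (HM0 X)) (carrier (HM0 X))"
    using homeomorphic_imp_surjective_map[OF homeomorphic_map_HM0_aut]
      homeomorphic_imp_injective_map[OF homeomorphic_map_HM0_aut]
    by (simp add: bij_betw_def topspace_HM0[OF X_top[OF TG]])
  have "HM0_aut X (f \<otimes>\<^bsub>HM0 X\<^esub> g) = HM0_aut X f \<otimes>\<^bsub>HM0 X\<^esub> HM0_aut X g"
    if f: "f \<in> carrier (HM0 X)" and g: "g \<in> carrier (HM0 X)" for f g
  proof -
    have "reparam (\<lambda>t. t\<^sup>2) (f \<otimes>\<^bsub>HM0 X\<^esub> g)
        = reparam (\<lambda>t. t\<^sup>2) f \<otimes>\<^bsub>HM0 X\<^esub> reparam (\<lambda>t. t\<^sup>2) g"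
      using unit_reparamD(1)[OF unit_reparam_square]
      by (simp add: HM0_mult reparam_def cong: restrict_cong)
    then show ?thesis
      by (simp only: HM0_aut_eq[OF f] HM0_aut_eq[OF g] HM0_aut_eq[OF HM0_mult_closed[OF TG f g]])
  qed
  then have "HM0_aut X \<in> hom (HM0 X) (HM0 X)"
    using bij_betw_imp_funcset[OF bij] by (simp add: hom_def)
  then show ?thesis using bij by (simp add: auto_def Bij_def HM0_aut_def)
qed

text \<open>The induction runs over all f at once, because the power \<open>Suc n\<close> unfolds to
  the n-th power applied to \<open>HM0_aut X f\<close>.\<close>

lemma HM0_aut_nat_pow:
  assumes f: "f \<in> carrier (HM0 X)"
  shows "(HM0_aut X [^]\<^bsub>AutoGroup (HM0 X)\<^esub> n) f = (\<lambda>t\<in>{0..<1}. f (t ^ 2 ^ n))"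
  using f
proof (induction n arbitrary: f)
  case 0
  then have "f \<in> carrier (HM X)" by (simp add: HM0_carrier_iff)
  then have "f = (\<lambda>t\<in>{0..<1}. f (t ^ 2 ^ 0))" by (rule HM_ext) simp_all
  then show ?case using 0 by (simp add: one_AutoGroup)
next
  case (Suc n)
  interpret A: group "AutoGroup (HM0 X)" by (rule group.AutoGroup[OF group_HM0[OF TG]])
  have an: "HM0_aut X [^]\<^bsub>AutoGroup (HM0 X)\<^esub> n \<in> auto (HM0 X)"
    using A.nat_pow_closed HM0_aut_in_auto by (simp add: carrier_AutoGroup)
  have c: "HM0_aut X f \<in> carrier (HM0 X)" by (rule auto_closed[OF HM0_aut_in_auto Suc.prems])
  have "(HM0_aut X [^]\<^bsub>AutoGroup (HM0 X)\<^esub> Suc n) f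
      = (HM0_aut X [^]\<^bsub>AutoGroup (HM0 X)\<^esub> n) (HM0_aut X f)"
    by (simp add: mult_AutoGroup[OF an HM0_aut_in_auto Suc.prems])
  also have "\<dots> = (\<lambda>t\<in>{0..<1}. HM0_aut X f (t ^ 2 ^ n))" by (rule Suc.IH[OF c])
  also have "\<dots> = (\<lambda>t\<in>{0..<1}. f (t ^ 2 ^ Suc n))"
  proof (rule restrict_ext)
    fix t :: real assume t: "t \<in> {0..<1}"
    then have "t ^ 2 ^ n \<in> {0..<1}" by (simp add: power_less_one_iff)
    then show "HM0_aut X f (t ^ 2 ^ n) = f (t ^ 2 ^ Suc n)"
      by (simp add: HM0_aut_eq[OF Suc.prems] reparam_def power_mult[symmetric] mult.commute)
  qed
  finally show ?case .
qed

lemma HM0_aut_attracts: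
  assumes f: "f \<in> carrier (HM0 X)" and W: "openin (HM0_topology X T) W" "\<one>\<^bsub>HM0 X\<^esub> \<in> W"
  shows "\<exists>m::int. (HM0_aut X [^]\<^bsub>AutoGroup (HM0 X)\<^esub> m) f \<in> W"
proof -
  obtain V \<delta> where V: "open_step_cover T (\<one>\<^bsub>HM0 X\<^esub>) V" and \<delta>: "0 < \<delta>"
    and sub: "HM_nbhd X V \<delta> \<inter> carrier (HM0 X) \<subseteq> W"
    using W unfolding openin_HM0_iff[OF X_top[OF TG]] by blast
  have Vs: "step V" using V by (simp add: open_step_cover_def)
  have V1: "\<one>\<^bsub>X\<^esub> \<in> V t" if "t \<in> {0..<1}" for t
    using V that by (simp add: open_step_cover_def HM0_one)
  obtain n a where part: "unit_partition n a"
    and a: "\<And>i t. i < n \<Longrightarrow> t \<in> {a i..<a (Suc i)} \<Longrightarrow> f t = f (a i)"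
    using step_imp_partition[OF HM0_step[OF f]] by blast
  have n: "n > 0" using part by (cases n) (auto simp: unit_partition_def)
  \<comment> \<open>\<open>a 1\<close> ends the first piece, on which f keeps the value f 0 =
    1.\<close>
  define c where "c = a 1"
  have c: "0 < c" and fc: "f t = \<one>\<^bsub>X\<^esub>" if "t \<in> {0..<c}" for t
  proof -
    have a0: "a 0 = 0" using part by (simp add: unit_partition_def)
    show "0 < c" using unit_partition_subset(2)[OF part n] a0 by (simp add: c_def)
    have "f t = f 0" using a[OF n, of t] that a0 by (simp add: c_def)
    then show "f t = \<one>\<^bsub>X\<^esub>" using f by (simp add: HM0_carrier_iff)
  qed
  \<comment> \<open>Exceptional arguments will be confined to [r,1]. Halving \<delta> makes its
    length strictly smaller than \<delta>, and the maximum with 0 covers the case \<delta> >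
    2.\<close>
  define r where "r = max 0 (1 - \<delta> / 2)"
  have r: "0 \<le> r" "r < 1" "1 - r < \<delta>" using \<delta> by (auto simp: r_def)
  have c0: "0 < c" using unit_partition_subset(2)[OF part n] part by (simp add: c_def unit_partition_def)
  \<comment> \<open>Powers of r tend to 0, and the exponent 2^m that actually occurs is at least
    m.\<close>
  obtain m where m: "r ^ m < c" using real_arch_pow_inv[OF c0 r(2)] by blast
  have "r ^ 2 ^ m \<le> r ^ m" using r by (intro power_decreasing) (auto intro: less_imp_le)
  with m have rm: "r ^ 2 ^ m < c" by simp
  define g where "g = (HM0_aut X [^]\<^bsub>AutoGroup (HM0 X)\<^esub> m) f"
  interpret A: group "AutoGroup (HM0 X)" by (rule group.AutoGroup[OF group_HM0[OF TG]])
  have g: "g \<in> carrier (HM0 X)"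
    unfolding g_def using A.nat_pow_closed HM0_aut_in_auto by (intro auto_closed[OF _ f]) (simp add: carrier_AutoGroup)
  have "measure lebesgue {t \<in> {0..<1}. g t \<notin> V t} \<le> measure lebesgue {r..1}"
  proof (intro measure_mono_fmeasurable fmeasurableD bad_set_lmeasurable[OF HM0_step[OF g] Vs])
    show "{t \<in> {0..<1}. g t \<notin> V t} \<subseteq> {r..1}"
    proof
      fix t assume "t \<in> {t \<in> {0..<1}. g t \<notin> V t}"
      then have t: "t \<in> {0..<1}" "g t \<notin> V t" by auto
      have "\<not> t < r"
      proof
        assume "t < r"
        then have "t ^ 2 ^ m \<le> r ^ 2 ^ m" using t(1) by (intro power_mono) auto
        then have "t ^ 2 ^ m \<in> {0..<c}" using rm t(1) by simp
        then have "g t = \<one>\<^bsub>X\<^esub>" using fc t(1) by (simp add: g_def HM0_aut_nat_pow[OF f])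
        then show False using t V1 by simp
      qed
      then show "t \<in> {r..1}" using t(1) by simp
    qed
  qed simp
  also have "\<dots> < \<delta>" using r by simp
  finally have "g \<in> HM_nbhd X V \<delta>" using g by (simp add: HM_nbhd_def HM0_carrier_iff)
  then have "g \<in> W" using sub g by blast
  then have "(HM0_aut X [^]\<^bsub>AutoGroup (HM0 X)\<^esub> int m) f \<in> W"
    by (simp add: g_def int_pow_int)
  then show ?thesis by blast
qed

subsection \<open>The embedding of \<open>X\<close>\<close>

text \<open>The unit near 0 places the function in \<open>HM0 X\<close>, and the rest of [0,1) has
  positive measure, so that the topology can detect x. The jump at 1/2 is an arbitrary choice
  strictly between 0 and 1.\<close>

definition step_embed :: "'a \<Rightarrow> real \<Rightarrow> 'a" where
  "step_embed x = (\<lambda>t\<in>{0..<1}. if t \<in> {1/2..<1} then x else \<one>\<^bsub>X\<^esub>)"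

lemma step_embed_closed: "x \<in> carrier X \<Longrightarrow> step_embed x \<in> carrier (HM0 X)"
  using HM_carrierI[OF step_comp[OF step_interval, of "\<lambda>b. if b then x else \<one>\<^bsub>X\<^esub>" "1/2" 1], of X]
    group.is_monoid[OF X_group[OF TG]]
  by (simp add: HM0_carrier_iff step_embed_def monoid.one_closed)

lemma step_embed_hom: "step_embed \<in> hom X (HM0 X)"
proof (rule homI)
  fix x y assume "x \<in> carrier X" "y \<in> carrier X"
  then show "step_embed (x \<otimes>\<^bsub>X\<^esub> y) = step_embed x \<otimes>\<^bsub>HM0 X\<^esub> step_embed y"
    using group.is_monoid[OF X_group[OF TG]]
    by (auto simp: HM0_mult step_embed_def monoid.l_one monoid.one_closed intro!: restrict_ext)
qed (rule step_embed_closed)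

lemma step_embed_half: "step_embed x (1/2) = x"
  by (simp add: step_embed_def)

text \<open>A subbasic set sees x only through the truth of x \<in> U. If x \<in> U, every y \<in> U
  yields the same exceptional set; if x \<notin> U, no y yields a larger one, and the whole space is
  a suitable neighborhood.\<close>

lemma continuous_map_step_embed: "continuous_map T (HM0_topology X T) step_embed"
  unfolding HM0_topology_def continuous_map_in_subtopology
proof
  have closed: "step_embed x \<in> carrier (HM X)" if "x \<in> topspace T" for x
    using step_embed_closed that X_top[OF TG] by (simp add: HM0_carrier_iff)
  show "step_embed \<in> topspace T \<rightarrow> carrier (HM0 X)"
    using step_embed_closed X_top[OF TG] by auto
  show "continuous_map T (HM_topology X T) step_embed"
    unfolding HM_topology_def
  proof (rule continuous_on_generated_topo)
    have "step_embed ` topspace T \<subseteq> topspace (HM_topology X T)"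
      unfolding topspace_HM[OF X_top[OF TG]] using closed by blast
    then show "step_embed ` topspace T \<subseteq>
        \<Union>{HM_subbasic X U a b \<epsilon> | U a b \<epsilon>. openin T U \<and> 0 \<le> a \<and> a < b \<and> b \<le> 1 \<and> 0 < \<epsilon>}"
      unfolding HM_topology_def topology_generated_by_topspace .
    fix N assume "N \<in> {HM_subbasic X U a b \<epsilon> | U a b \<epsilon>. openin T U \<and> 0 \<le> a \<and> a < b \<and> b \<le> 1 \<and> 0 < \<epsilon>}"
    then obtain U a b \<epsilon> where N: "N = HM_subbasic X U a b \<epsilon>" and U: "openin T U" by blast
    define B where "B x = {a..<b} - {t \<in> {0..<1}. step_embed x t \<in> U}" for x
    have mem: "x \<in> step_embed -` N \<inter> topspace T \<longleftrightarrow> x \<in> topspace T \<and> measure lebesgue (B x) < \<epsilon>" for x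
      using closed by (auto simp: N HM_subbasic_def B_def)
    show "openin T (step_embed -` N \<inter> topspace T)"
    proof (subst openin_subopen, intro ballI)
      fix x assume x: "x \<in> step_embed -` N \<inter> topspace T"
      show "\<exists>O'. openin T O' \<and> x \<in> O' \<and> O' \<subseteq> step_embed -` N \<inter> topspace T"
      proof (cases "x \<in> U")
        case True
        have "B y = B x" if "y \<in> U" for y
          using True that by (auto simp: B_def step_embed_def)
        then have "U \<subseteq> step_embed -` N \<inter> topspace T"
          using x openin_subset[OF U] unfolding subset_iff mem by metis
        then show ?thesis using True U by blast
      next
        case False
        have "topspace T \<subseteq> step_embed -` N \<inter> topspace T"
        proof
          fix y assume y: "y \<in> topspace T"
          have meas: "B z \<in> lmeasurable" if "z \<in> topspace T" for z
            unfolding B_def using HM_carrier_step[OF closed[OF that]]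
            by (intro fmeasurable_Diff fmeasurableD[OF step_lmeasurable]
                step_comp[of "step_embed z" "\<lambda>x. x \<in> U"] bounded_set_imp_lmeasurable) auto
          have "B y \<subseteq> B x" using False by (auto simp: B_def step_embed_def)
          then have "measure lebesgue (B y) \<le> measure lebesgue (B x)"
            using meas x y by (intro measure_mono_fmeasurable fmeasurableD) auto
          then show "y \<in> step_embed -` N \<inter> topspace T" using x y unfolding mem by simp
        qed
        then show ?thesis using x by blast
      qed
    qed
  qed
qed

text \<open>The inverse is evaluation at 1/2, which is in general not continuous on all of
  \<open>HM0 X\<close>. On the image it is, because there a value outside U persists on all of
  [1/2,1).\<close>

lemma embedding_map_step_embed: "embedding_map T (HM0_topology X T) step_embed"
proof -
  let ?H = "step_embed ` topspace T"
  have ev: "continuous_map (subtopology (HM0_topology X T) ?H) T (\<lambda>f. f (1/2))"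
    unfolding continuous_map_def
  proof (intro conjI allI impI)
    show "(\<lambda>f. f (1/2)) \<in> topspace (subtopology (HM0_topology X T) ?H) \<rightarrow> topspace T"
      using step_embed_half by auto
    fix U assume U: "openin T U"
    have sub: "?H \<subseteq> carrier (HM0 X)" using step_embed_closed X_top[OF TG] by auto
    \<comment> \<open>For f in the image the exceptional part of [1/2,1) has measure 0 or 1/2, and
      the strict bound 1/2 separates the two cases.\<close>
    have "f (1/2) \<in> U \<longleftrightarrow> f \<in> HM_subbasic X U (1/2) 1 (1/2)" if "f \<in> ?H" for f
    proof -
      from that obtain x where x: "x \<in> topspace T" "f = step_embed x" by blast
      have fc: "f \<in> carrier (HM X)" using subsetD[OF sub that] by (simp add: HM0_carrier_iff)
      have "{1/2..<1} - {t \<in> {0..<1}. f t \<in> U} = (if x \<in> U then {} else {1/2..<1::real})"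
        by (auto simp: x(2) step_embed_def)
      then have "measure lebesgue ({1/2..<1} - {t \<in> {0..<1}. f t \<in> U}) = (if x \<in> U then 0 else 1/2)"
        by simp
      then show ?thesis using fc by (simp add: HM_subbasic_def x(2) step_embed_half del: Diff_iff)
    qed
    then have "{f \<in> topspace (subtopology (HM0_topology X T) ?H). f (1/2) \<in> U}
        = HM_subbasic X U (1/2) 1 (1/2) \<inter> carrier (HM0 X) \<inter> ?H"
      using sub by (auto simp: topspace_HM0[OF X_top[OF TG]])
    moreover have "openin (HM_topology X T) (HM_subbasic X U (1/2) 1 (1/2))"
      using U by (rule openin_HM_subbasic) simp_all
    ultimately show "openin (subtopology (HM0_topology X T) ?H)
        {f \<in> topspace (subtopology (HM0_topology X T) ?H). f (1/2) \<in> U}"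
      by (auto simp: HM0_topology_def openin_subtopology)
  qed
  have "homeomorphic_maps T (subtopology (HM0_topology X T) ?H) step_embed (\<lambda>f. f (1/2))"
    unfolding homeomorphic_maps_def
  proof (intro conjI ballI ev)
    show "continuous_map T (subtopology (HM0_topology X T) ?H) step_embed"
      using continuous_map_step_embed by (auto simp: continuous_map_in_subtopology)
    show "step_embed (f (1/2)) = f" if "f \<in> topspace (subtopology (HM0_topology X T) ?H)" for f
      using that step_embed_half by auto
  qed (rule step_embed_half)
  then show ?thesis unfolding embedding_map_def homeomorphic_map_maps by blast
qed

end

theorem corollary1:
  fixes X :: "('a, 'b) monoid_scheme" and T :: "'a topology"
  assumes "topological_group X T"
  shows "topological_group (semidirect_int (HM0 X) (HM0_aut X))
           (semidirect_int_topology (HM0_topology X T))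
     \<and> duoseparable (semidirect_int (HM0 X) (HM0_aut X))
           (semidirect_int_topology (HM0_topology X T))
     \<and> contains_topological_copy (semidirect_int (HM0 X) (HM0_aut X))
           (semidirect_int_topology (HM0_topology X T)) X T"
proof (intro conjI)
  note TG = topological_group_HM0[OF assms] and aut = HM0_aut_in_auto[OF assms]
  show "topological_group (semidirect_int (HM0 X) (HM0_aut X))
      (semidirect_int_topology (HM0_topology X T))"
    by (rule topological_group_semidirect[OF TG aut homeomorphic_map_HM0_aut[OF assms]])
  show "duoseparable (semidirect_int (HM0 X) (HM0_aut X))
      (semidirect_int_topology (HM0_topology X T))"
    by (rule duoseparable_semidirect[OF TG aut HM0_aut_attracts[OF assms]])
  have "inj_on (step_embed X) (carrier X)"
    by (rule inj_on_inverseI[where g = "\<lambda>f. f (1/2)"]) (rule step_embed_half[OF assms])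
  then show "contains_topological_copy (semidirect_int (HM0 X) (HM0_aut X))
      (semidirect_int_topology (HM0_topology X T)) X T"
    by (rule contains_topological_copy_semidirect[OF TG aut X_group[OF assms] X_top[OF assms]
          step_embed_hom[OF assms] _ embedding_map_step_embed[OF assms]])
qed

end
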